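(* Let $n\ge 1$ and let $\mu\not\equiv 0$ be a nonnegative locally finite Borel measure on $\mathbb{R}^n$ such that $\mu(E+z)=\mu(E)$ for every Borel set $E\subset\mathbb{R}^n$ and every $z\in\mathbb{Z}^n$. Let $P(x)=\frac12 x^{\top}Ax+b\cdot x+c$ be a quadratic function with $A$ a positive definite symmetric $n\times n$ matrix satisfying $\det A=\mu(\mathbb{T}^n)$, $b\in\mathbb{R}^n$ and $c\in\mathbb{R}$. Then there exists a $\mathbb{Z}^n$-periodic function $v$ such that $u=v+P$ is a continuous convex function on $\mathbb{R}^n$ solving $\det D^2u=\mu$ in $\mathbb{R}^n$ in the Alexandrov sense; moreover, $v$ is unique up to an additive constant.
   Context: A convex function $u$ on $\mathbb{R}^n$ solves $\det D^2u=\mu$ in the Alexandrov sense if its Monge-Amp\`ere measure $E\mapsto|\partial u(E)|$ equals $\mu$, where $\partial u$ is the subdifferential and $|\cdot|$ is Lebesgue measure. $\mathbb{T}^n=\mathbb{R}^n/\mathbb{Z}^n$, and $\mu(\mathbb{T}^n)$ is the mass of $\mu$ in one period, i.e. $\mu([0,1)^n)$. A function $v$ on $\mathbb{R}^n$ is $\mathbb{Z}^n$-periodic if $v(x+z)=v(x)$ for all $x\in\mathbb{R}^n$, $z\in\mathbb{Z}^n$. *)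

theory Defs
  imports "HOL-Analysis.Analysis"
begin

definition integer_lattice :: "(real ^ 'n) set" where
  "integer_lattice = {z. \<forall>i. z $ i \<in> \<int>}"

definition unit_cell :: "(real ^ 'n) set" where
  "unit_cell = {x. \<forall>i. 0 \<le> x $ i \<and> x $ i < 1}"

definition lattice_periodic :: "(real ^ 'n \<Rightarrow> real) \<Rightarrow> bool" where
  "lattice_periodic v \<longleftrightarrow> (\<forall>x. \<forall>z\<in>integer_lattice. v (x + z) = v x)"

definition lattice_periodic_measure :: "(real ^ 'n) measure \<Rightarrow> bool" where
  "lattice_periodic_measure \<mu> \<longleftrightarrow>
     (\<forall>E\<in>sets borel. \<forall>z\<in>integer_lattice. emeasure \<mu> ((\<lambda>x. x + z) ` E) = emeasure \<mu> E)"

definition locally_finite_measure :: "'a::topological_space measure \<Rightarrow> bool" where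
  "locally_finite_measure \<mu> \<longleftrightarrow> (\<forall>x. \<exists>U. open U \<and> x \<in> U \<and> emeasure \<mu> U < \<infinity>)"

definition symmetric_positive_definite :: "real ^ 'n ^ 'n \<Rightarrow> bool" where
  "symmetric_positive_definite A \<longleftrightarrow>
     transpose A = A \<and> (\<forall>x. x \<noteq> 0 \<longrightarrow> x \<bullet> (A *v x) > 0)"

definition quadratic_function ::
    "real ^ 'n ^ 'n \<Rightarrow> real ^ 'n \<Rightarrow> real \<Rightarrow> real ^ 'n \<Rightarrow> real" where
  "quadratic_function A b c x = (1/2) * (x \<bullet> (A *v x)) + b \<bullet> x + c"

definition subdifferential :: "('a::real_inner \<Rightarrow> real) \<Rightarrow> 'a \<Rightarrow> 'a set" where
  "subdifferential u x = {p. \<forall>y. u y \<ge> u x + p \<bullet> (y - x)}"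

definition subdifferential_image :: "('a::real_inner \<Rightarrow> real) \<Rightarrow> 'a set \<Rightarrow> 'a set" where
  "subdifferential_image u E = (\<Union>x\<in>E. subdifferential u x)"

text \<open>The image of a Borel set under the subdifferential of a convex function is Lebesgue
  measurable, but in general not Borel, hence the use of \<^const>\<open>lebesgue\<close>.
  Measurability is demanded explicitly because \<^const>\<open>emeasure\<close> takes the value 0 on
  non-measurable sets.\<close>

definition alexandrov_solution :: "('a::euclidean_space \<Rightarrow> real) \<Rightarrow> 'a measure \<Rightarrow> bool" where
  "alexandrov_solution u \<mu> \<longleftrightarrow>
     convex_on UNIV u \<and>
     (\<forall>E\<in>sets borel. subdifferential_image u E \<in> sets lebesgue \<and>
        emeasure lebesgue (subdifferential_image u E) = emeasure \<mu> E)"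

end

theory Submission
  imports Defs "HOL-Complex_Analysis.Great_Picard"
begin

text \<open>
  The equation is an optimal transport problem on the torus: a convex \<open>u\<close> with \<open>u - P\<close> periodic
  solves \<open>det D\<^sup>2u = \<mu>\<close> exactly when the gradient of its Legendre transform, the (almost everywhere
  defined) inverse of \<open>\<partial>u\<close>, carries Lebesgue measure to \<open>\<mu>\<close>. Both existence and uniqueness are then
  read off from Kantorovich duality.

  Slopes are written as \<open>p = A y + b\<close>. With \<open>cost w = (1/2) w \<bullet> A w\<close> and \<open>u = v + P\<close>, the slope \<open>A y + b\<close>
  is a subgradient of \<open>u\<close> at \<open>x\<close> iff \<open>x\<close> maximizes \<open>- cost (x - y) - v x\<close>
  (\<open>subdifferential_iff_maximizers\<close>), and the maximum, \<open>transform v y\<close>, is a periodic function of \<open>y\<close>: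
  it is the Legendre transform of \<open>u\<close> minus that of \<open>P\<close>, in the new coordinate.

  The maximizer is unique for almost every \<open>y\<close> (\<open>ambiguous_null\<close>). Maximizers depend monotonically on
  \<open>y\<close>, so the set where their \<open>i\<close>-th coordinates straddle a given gap meets each line in the direction
  \<open>A\<^sup>-\<^sup>1 e\<^sub>i\<close> at most once, and a bounded piece of a set with that property has infinitely
  many disjoint translates inside a bounded region. Hence there is a Borel map \<open>optimal_map v\<close> commuting with lattice
  translations, and a convex \<open>v + P\<close> is an Alexandrov solution iff this map pushes \<open>det A\<close> times Lebesgue
  measure forward to \<open>\<mu>\<close> (\<open>alexandrov_iff_push_forward\<close>); the factor \<open>det A\<close> comes from \<open>y \<mapsto> A y + b\<close>.

  Existence. Minimize \<open>\<integral> v d\<mu> + det A \<integral> transform v dy\<close>, both integrals over the unit cell. The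
  double transform does not increase the functional, and transforms are locally Lipschitz with a constant
  that depends on \<open>A\<close> only, so Arzela-Ascoli gives a minimizer (\<open>dual_functional_attains_minimum\<close>).
  The derivative of \<open>transform (v + t \<phi>) y\<close> at \<open>t = 0\<close> is \<open>- \<phi> (optimal_map v y)\<close> for almost every \<open>y\<close>,
  so stationarity says that \<open>\<mu>\<close> and the push-forward have the same integral against every
  continuous periodic \<open>\<phi>\<close>, and they agree (\<open>minimizer_pushes_forward\<close>). The double transform of a
  minimizer is again a minimizer, and it is convex once \<open>P\<close> is added.

  Uniqueness. If \<open>optimal_map v\<close> pushes \<open>det A\<close> times Lebesgue measure forward to \<open>\<mu>\<close>, then integrating
  \<open>w x + transform w y \<ge> - cost (x - y)\<close>, with equality for \<open>w = v\<close>, along \<open>x = optimal_map v y\<close> shows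
  that \<open>v\<close> is a minimizer. For two solutions equality must hold almost everywhere, so their maximizer
  sets intersect at almost every \<open>y\<close>, hence at every \<open>y\<close> by closedness (\<open>common_maximizers\<close>).
  Two convex functions with a common subgradient everywhere differ by a constant
  (\<open>transform_diff_constant\<close>), and a convex solution is recovered from its transform.
\<close>

section \<open>Lattice translations and fundamental domains\<close>

lemma integer_lattice_uminus: "z \<in> integer_lattice \<Longrightarrow> - z \<in> integer_lattice"
  by (simp add: integer_lattice_def)

lemma integer_lattice_add:
  "z \<in> integer_lattice \<Longrightarrow> w \<in> integer_lattice \<Longrightarrow> z + w \<in> integer_lattice"
  by (simp add: integer_lattice_def)

lemma translate_eq_vimage: "(\<lambda>x. x + z) ` S = (\<lambda>x. x - z) -` S" for z :: "'a::ab_group_add"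
proof (intro set_eqI iffI)
  fix x assume "x \<in> (\<lambda>x. x - z) -` S"
  then show "x \<in> (\<lambda>x. x + z) ` S"
    by (intro image_eqI[of _ _ "x - z"]) auto
qed auto

lemma infinite_integer_lattice: "infinite (integer_lattice :: (real^'n) set)"
proof -
  have "inj (\<lambda>k::nat. (\<chi> i. real k) :: real^'n)"
    by (auto simp: inj_def vec_eq_iff)
  then have "infinite (range (\<lambda>k::nat. (\<chi> i. real k) :: real^'n))"
    by (rule range_inj_infinite)
  moreover have "range (\<lambda>k::nat. (\<chi> i. real k) :: real^'n) \<subseteq> integer_lattice"
    by (auto simp: integer_lattice_def)
  ultimately show ?thesis
    using finite_subset by blast
qed

lemma countable_integer_lattice: "countable (integer_lattice :: (real^'n) set)"
proof -
  have "countable (range (\<lambda>f::'n \<Rightarrow> int. (\<chi> i. of_int (f i)) :: real^'n))"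
    by (intro countable_image) auto
  moreover have "integer_lattice \<subseteq> range (\<lambda>f::'n \<Rightarrow> int. (\<chi> i. of_int (f i)) :: real^'n)"
  proof
    fix z :: "real^'n" assume "z \<in> integer_lattice"
    then have "z = (\<chi> i. of_int \<lfloor>z $ i\<rfloor>)"
      by (auto simp: integer_lattice_def vec_eq_iff)
    then show "z \<in> range (\<lambda>f::'n \<Rightarrow> int. (\<chi> i. of_int (f i)) :: real^'n)"
      by (metis rangeI)
  qed
  ultimately show ?thesis
    by (rule countable_subset[rotated])
qed

definition fundamental_domain :: "(real^'n) set \<Rightarrow> bool" where
  "fundamental_domain D \<longleftrightarrow> D \<in> sets borel \<and> (\<forall>x. \<exists>!z. z \<in> integer_lattice \<and> x + z \<in> D)"

lemma fundamental_domain_box: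
  fixes a :: "real^'n"
  shows "fundamental_domain {x. \<forall>i. a $ i \<le> x $ i \<and> x $ i < a $ i + 1}"
  unfolding fundamental_domain_def
proof (intro conjI allI)
  let ?D = "{x::real^'n. \<forall>i. a $ i \<le> x $ i \<and> x $ i < a $ i + 1}"
  have "{x \<in> space borel. \<forall>i\<in>UNIV. a $ i \<le> x $ i \<and> x $ i < a $ i + 1} \<in> sets borel"
    by measurable
  then show "?D \<in> sets borel" by simp
  fix x :: "real^'n"
  show "\<exists>!z. z \<in> integer_lattice \<and> x + z \<in> ?D"
  proof (rule ex1I)
    show "(\<chi> i. - of_int \<lfloor>x $ i - a $ i\<rfloor>) \<in> integer_lattice \<and>
        x + (\<chi> i. - of_int \<lfloor>x $ i - a $ i\<rfloor>) \<in> ?D"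
      by (auto simp: integer_lattice_def) linarith+
    fix z assume z: "z \<in> integer_lattice \<and> x + z \<in> ?D"
    show "z = (\<chi> i. - of_int \<lfloor>x $ i - a $ i\<rfloor>)"
    proof (simp add: vec_eq_iff, intro allI)
      fix i
      obtain k where k: "z $ i = of_int k"
        using z by (metis (mono_tags, lifting) Ints_cases integer_lattice_def mem_Collect_eq)
      have "a $ i \<le> x $ i + z $ i \<and> x $ i + z $ i < a $ i + 1"
        using z by auto
      then have "\<lfloor>x $ i - a $ i\<rfloor> = - k"
        unfolding k by linarith
      then show "z $ i = - of_int \<lfloor>x $ i - a $ i\<rfloor>"
        using k by simp
    qed
  qed
qed

lemma fundamental_domain_unit_cell: "fundamental_domain (unit_cell :: (real^'n) set)"
  using fundamental_domain_box[of "0 :: real^'n"] by (simp add: unit_cell_def)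

lemma unit_cell_borel [measurable]: "unit_cell \<in> sets borel"
  by (rule fundamental_domain_unit_cell[unfolded fundamental_domain_def, THEN conjunct1])

lemma lattice_translate_into_unit_cell:
  obtains z where "z \<in> integer_lattice" "x + z \<in> unit_cell"
proof -
  have "\<exists>!z. z \<in> integer_lattice \<and> x + z \<in> unit_cell"
    using fundamental_domain_unit_cell unfolding fundamental_domain_def by blast
  then show ?thesis using that by blast
qed

lemma unit_cell_subset_cbox: "unit_cell \<subseteq> (cbox 0 1 :: (real^'n) set)"
  by (auto simp: unit_cell_def mem_box_cart less_imp_le)

lemma nn_integral_lattice_translate:
  fixes \<nu> :: "(real^'n) measure"
  assumes sets: "sets \<nu> = sets borel" and per: "lattice_periodic_measure \<nu>"
    and z: "z \<in> integer_lattice" and g: "g \<in> borel_measurable borel"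
  shows "(\<integral>\<^sup>+x. g (x + z) \<partial>\<nu>) = (\<integral>\<^sup>+x. g x \<partial>\<nu>)"
proof -
  have m: "(\<lambda>x. x + z) \<in> measurable \<nu> borel"
    using sets by (simp cong: measurable_cong_sets)
  have "distr \<nu> borel (\<lambda>x. x + z) = \<nu>"
  proof (rule measure_eqI)
    show "sets (distr \<nu> borel (\<lambda>x. x + z)) = sets \<nu>"
      by (simp add: sets)
    fix E assume "E \<in> sets (distr \<nu> borel (\<lambda>x. x + z))"
    then have E: "E \<in> sets borel" by simp
    have sp: "space \<nu> = UNIV"
      using sets_eq_imp_space_eq[OF sets] by simp
    have vim: "(\<lambda>x. x + z) -` E = (\<lambda>x. x + - z) ` E"
      using translate_eq_vimage[of "- z" E] by simp
    have "emeasure (distr \<nu> borel (\<lambda>x. x + z)) E = emeasure \<nu> ((\<lambda>x. x + - z) ` E)"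
      by (subst emeasure_distr[OF m E]) (simp add: sp vim)
    also have "\<dots> = emeasure \<nu> E"
      using per E integer_lattice_uminus[OF z] unfolding lattice_periodic_measure_def by blast
    finally show "emeasure (distr \<nu> borel (\<lambda>x. x + z)) E = emeasure \<nu> E" .
  qed
  then have "(\<integral>\<^sup>+x. g x \<partial>\<nu>) = (\<integral>\<^sup>+x. g x \<partial>distr \<nu> borel (\<lambda>x. x + z))"
    by simp
  also have "\<dots> = (\<integral>\<^sup>+x. g (x + z) \<partial>\<nu>)"
    by (rule nn_integral_distr[OF m]) (use g in simp)
  finally show ?thesis by simp
qed

text \<open>The integral of a periodic function over one period does not depend on the choice of the period.
  Cut \<open>D\<close> into the pieces that single lattice vectors \<open>z\<close> move into \<open>D'\<close>; translating each of them by \<open>z\<close>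
  reassembles \<open>D'\<close>. This is used with \<open>D\<close> the preimage of the unit cell under a transport map, and
  with \<open>D\<close> a box chosen around a given set.\<close>

lemma nn_integral_fundamental_domain_cong:
  fixes \<nu> :: "(real^'n) measure" and f :: "real^'n \<Rightarrow> ennreal"
  assumes sets: "sets \<nu> = sets borel" and per: "lattice_periodic_measure \<nu>"
    and D: "fundamental_domain D" and D': "fundamental_domain D'"
    and f: "f \<in> borel_measurable borel"
    and fper: "\<And>x z. z \<in> integer_lattice \<Longrightarrow> f (x + z) = f x"
  shows "(\<integral>\<^sup>+x. f x * indicator D x \<partial>\<nu>) = (\<integral>\<^sup>+x. f x * indicator D' x \<partial>\<nu>)"
proof -
  obtain e :: "nat \<Rightarrow> real^'n" where e: "bij_betw e UNIV integer_lattice"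
    using countable_infiniteE'[OF countable_integer_lattice infinite_integer_lattice] by blast
  have eL: "e k \<in> integer_lattice" for k
    using e by (auto simp: bij_betw_def)
  have Db[measurable]: "D \<in> sets borel" "D' \<in> sets borel"
    using D D' by (auto simp: fundamental_domain_def)
  note f[measurable]
  have meas: "h \<in> borel_measurable \<nu>" if "h \<in> borel_measurable borel" for h :: "real^'n \<Rightarrow> ennreal"
    using that sets by (simp cong: measurable_cong_sets)
  have one: "(\<Sum>k. indicator F (x + d k)) = (1::ennreal)"
    if F: "fundamental_domain F" and d: "bij_betw d UNIV integer_lattice" for F x and d :: "nat \<Rightarrow> _"
  proof -
    have "\<exists>!z. z \<in> integer_lattice \<and> x + z \<in> F"
      using F unfolding fundamental_domain_def by blast
    then obtain z where z: "z \<in> integer_lattice" "x + z \<in> F"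
        "\<And>w. w \<in> integer_lattice \<Longrightarrow> x + w \<in> F \<Longrightarrow> w = z"
      by blast
    obtain k where k: "d k = z"
      using bij_betw_imp_surj_on[OF d] z(1) by (metis imageE)
    have "indicator F (x + d j) = (if j = k then 1 else 0 :: ennreal)" for j
    proof (cases "j = k")
      case False
      then have "d j \<noteq> z"
        using bij_betw_imp_inj_on[OF d] k by (auto dest: injD)
      then have "x + d j \<notin> F"
        using z(3) bij_betwE[OF d] by blast
      then show ?thesis using False by simp
    qed (use z(2) k in simp)
    then have "(\<lambda>j. indicator F (x + d j)) = (\<lambda>j. if j = k then 1 else 0 :: ennreal)"
      by (rule ext)
    then show ?thesis
      using sums_single[of k "\<lambda>_. 1::ennreal", THEN sums_unique] by (simp only:)
  qed
  have "bij_betw (\<lambda>k. - e k) UNIV integer_lattice"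
  proof -
    have "bij_betw uminus integer_lattice (integer_lattice :: (real^'n) set)"
      by (rule bij_betwI[where g = uminus]) (auto intro: integer_lattice_uminus)
    from bij_betw_trans[OF e this] show ?thesis by (simp only: o_def)
  qed
  then have one': "(\<Sum>k. indicator D (x - e k)) = (1::ennreal)" for x
    using one[OF D, of "\<lambda>k. - e k" x] by (simp only: diff_conv_add_uminus)
  \<comment> \<open>Exactly one term of the series is nonzero, by \<open>one\<close>; the translation by \<open>e k\<close> swaps the two domains.\<close>
  have "(\<integral>\<^sup>+x. f x * indicator D x \<partial>\<nu>)
      = (\<integral>\<^sup>+x. (\<Sum>k. f x * indicator D x * indicator D' (x + e k)) \<partial>\<nu>)"
    by (intro nn_integral_cong) (simp add: one[OF D' e])
  also have "\<dots> = (\<Sum>k. \<integral>\<^sup>+x. f x * indicator D x * indicator D' (x + e k) \<partial>\<nu>)"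
    by (intro nn_integral_suminf meas) measurable
  also have "\<dots> = (\<Sum>k. \<integral>\<^sup>+x. f x * indicator D' x * indicator D (x - e k) \<partial>\<nu>)"
  proof (intro suminf_cong)
    fix k
    have "(\<integral>\<^sup>+x. f x * indicator D x * indicator D' (x + e k) \<partial>\<nu>)
       = (\<integral>\<^sup>+x. f (x + e k) * indicator D' (x + e k) * indicator D (x + e k - e k) \<partial>\<nu>)"
      by (intro nn_integral_cong) (simp add: fper[OF eL] mult_ac)
    also have "\<dots> = (\<integral>\<^sup>+x. f x * indicator D' x * indicator D (x - e k) \<partial>\<nu>)"
      by (rule nn_integral_lattice_translate[OF sets per eL]) measurable
    finally show "(\<integral>\<^sup>+x. f x * indicator D x * indicator D' (x + e k) \<partial>\<nu>)
       = (\<integral>\<^sup>+x. f x * indicator D' x * indicator D (x - e k) \<partial>\<nu>)" .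
  qed
  also have "\<dots> = (\<integral>\<^sup>+x. (\<Sum>k. f x * indicator D' x * indicator D (x - e k)) \<partial>\<nu>)"
    by (intro nn_integral_suminf[symmetric] meas) measurable
  also have "\<dots> = (\<integral>\<^sup>+x. f x * indicator D' x \<partial>\<nu>)"
    by (intro nn_integral_cong) (simp add: one')
  finally show ?thesis .
qed

lemma lattice_periodic_bounded:
  fixes v :: "real^'n \<Rightarrow> real"
  assumes "lattice_periodic v" "continuous_on UNIV v"
  obtains K where "\<And>x. \<bar>v x\<bar> \<le> K"
proof -
  have "compact (v ` cbox 0 1)"
    by (intro compact_continuous_image continuous_on_subset[OF assms(2)]) auto
  then obtain K where K: "\<And>x. x \<in> cbox 0 1 \<Longrightarrow> \<bar>v x\<bar> \<le> K"
    using compact_imp_bounded bounded_iff by (metis imageI real_norm_def)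
  have "\<bar>v x\<bar> \<le> K" for x
  proof -
    obtain z where z: "z \<in> integer_lattice" "x + z \<in> unit_cell"
      by (rule lattice_translate_into_unit_cell)
    have "v x = v (x + z)"
      using assms(1) z(1) by (simp add: lattice_periodic_def)
    then show ?thesis using K z(2) unit_cell_subset_cbox by (metis subsetD)
  qed
  then show ?thesis by (rule that)
qed

section \<open>The quadratic cost and its transform\<close>

locale pos_def_matrix =
  fixes A :: "real^'n^'n"
  assumes spd: "symmetric_positive_definite A"
begin

definition cost :: "real^'n \<Rightarrow> real" where
  "cost w = (1/2) * (w \<bullet> (A *v w))"

text \<open>The \<open>c\<close>-transform of optimal transport. Because \<open>cost\<close> is even, the same operator serves for both
  variables.\<close>

definition transform :: "(real^'n \<Rightarrow> real) \<Rightarrow> real^'n \<Rightarrow> real" where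
  "transform v y = (SUP x. - cost (x - y) - v x)"

definition maximizers :: "(real^'n \<Rightarrow> real) \<Rightarrow> real^'n \<Rightarrow> (real^'n) set" where
  "maximizers v y = {x. \<forall>x'. - cost (x' - y) - v x' \<le> - cost (x - y) - v x}"

lemma inner_A_commute: "x \<bullet> (A *v y) = y \<bullet> (A *v x)"
proof -
  have "transpose A = A"
    using spd by (simp add: symmetric_positive_definite_def)
  then show ?thesis
    by (metis dot_lmul_matrix inner_commute transpose_matrix_vector)
qed

lemma inner_A_pos: "x \<noteq> 0 \<Longrightarrow> 0 < x \<bullet> (A *v x)"
  using spd by (simp add: symmetric_positive_definite_def)

lemma A_inj: "A *v x = A *v y \<Longrightarrow> x = y"
  using inner_A_pos[of "x - y"] by (auto simp: matrix_vector_mult_diff_distrib)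

lemma surj_A: "surj ((*v) A)"
  using A_inj matrix_left_invertible_injective[of A] matrix_left_right_inverse[of A]
    matrix_right_invertible_surjective[of A] by (metis injI)

lemma cost_diff: "cost (x - y) = cost x + cost y - x \<bullet> (A *v y)"
  using inner_A_commute[of x y]
  by (simp add: cost_def matrix_vector_mult_diff_distrib inner_diff_left inner_diff_right)

lemma cost_nonneg: "0 \<le> cost w"
  using inner_A_pos[of w] by (cases "w = 0") (auto simp: cost_def)

lemma cost_minus_commute: "cost (x - y) = cost (y - x)"
  using inner_A_commute[of x y] by (simp add: cost_diff)

lemma continuous_on_A [continuous_intros]:
  "continuous_on S f \<Longrightarrow> continuous_on S (\<lambda>x. A *v f x)"
  by (rule bounded_linear.continuous_on[OF matrix_vector_mul_bounded_linear])

lemma continuous_on_cost [continuous_intros]: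
  "continuous_on S f \<Longrightarrow> continuous_on S (\<lambda>x. cost (f x))"
  unfolding cost_def by (intro continuous_intros)

lemma cost_coercive:
  obtains l where "0 < l" "\<And>w. l * (norm w)\<^sup>2 \<le> cost w"
proof -
  have ne: "sphere 0 1 \<noteq> ({} :: (real^'n) set)"
    by simp
  have "continuous_on (sphere 0 1) cost"
    by (intro continuous_on_cost continuous_on_id)
  from continuous_attains_inf[OF compact_sphere ne this] obtain s :: "real^'n" where
    s: "norm s = 1" "\<And>w. norm w = 1 \<Longrightarrow> cost s \<le> cost w"
    by auto
  have "s \<noteq> 0" using s(1) by auto
  then have pos: "0 < cost s"
    using inner_A_pos by (simp add: cost_def)
  have "cost s * (norm w)\<^sup>2 \<le> cost w" for w
  proof (cases "w = 0")
    case False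
    have "w = norm w *\<^sub>R (w /\<^sub>R norm w)"
      using False by simp
    then have "cost w = cost (norm w *\<^sub>R (w /\<^sub>R norm w))"
      by (simp only:)
    also have "\<dots> = (norm w)\<^sup>2 * cost (w /\<^sub>R norm w)"
      by (simp add: cost_def matrix_vector_mult_scaleR power2_eq_square)
    also have "\<dots> \<ge> (norm w)\<^sup>2 * cost s"
      using False by (intro mult_left_mono s(2)) auto
    finally show ?thesis by (simp add: mult.commute)
  qed (simp add: cost_def)
  with pos show ?thesis by (rule that)
qed

text \<open>Since \<open>v\<close> is periodic, any competitor can be moved by a lattice vector to a place where the cost is at
  most this bound. All the estimates that are uniform in \<open>v\<close> come from that.\<close>

definition cell_bound :: real where
  "cell_bound = (SUP w\<in>cbox 0 1. cost w)"

definition radius :: real where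
  "radius = (SOME R. 0 < R \<and> (\<forall>w. cost w \<le> cell_bound \<longrightarrow> norm w \<le> R))"

lemma cost_unit_cell_le: "w \<in> unit_cell \<Longrightarrow> cost w \<le> cell_bound"
  unfolding cell_bound_def
proof (rule cSUP_upper)
  have "continuous_on (cbox 0 1) cost"
    by (intro continuous_on_cost continuous_on_id)
  then have "bounded (cost ` cbox 0 1)"
    by (intro compact_imp_bounded compact_continuous_image) auto
  then show "bdd_above (cost ` cbox 0 1)"
    by (rule bounded_imp_bdd_above)
  show "w \<in> unit_cell \<Longrightarrow> w \<in> cbox 0 1"
    using unit_cell_subset_cbox by blast
qed

lemma cell_bound_nonneg: "0 \<le> cell_bound"
  using cost_unit_cell_le[of 0] by (simp add: cost_def unit_cell_def)

lemma radius: "0 < radius" "cost w \<le> cell_bound \<Longrightarrow> norm w \<le> radius"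
proof -
  obtain l where l: "0 < l" "\<And>w. l * (norm w)\<^sup>2 \<le> cost w"
    using cost_coercive by blast
  have "norm w \<le> sqrt (cell_bound / l) + 1" if "cost w \<le> cell_bound" for w
  proof -
    have "(norm w)\<^sup>2 \<le> cell_bound / l"
      using l(2)[of w] that l(1) by (simp add: field_simps)
    then have "norm w \<le> sqrt (cell_bound / l)"
      by (rule real_le_rsqrt)
    then show ?thesis by simp
  qed
  moreover have "0 \<le> sqrt (cell_bound / l)"
    using cell_bound_nonneg l(1) by simp
  ultimately have "\<exists>R. 0 < R \<and> (\<forall>w. cost w \<le> cell_bound \<longrightarrow> norm w \<le> R)"
    by (intro exI[of _ "sqrt (cell_bound / l) + 1"]) (auto simp: add_nonneg_pos)
  from someI_ex[OF this] show "0 < radius" "cost w \<le> cell_bound \<Longrightarrow> norm w \<le> radius"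
    unfolding radius_def by blast+
qed

lemma lattice_translate_near:
  obtains z where "z \<in> integer_lattice" "cost (x + z - y) \<le> cell_bound"
proof -
  obtain z where "z \<in> integer_lattice" "x - y + z \<in> unit_cell"
    by (rule lattice_translate_into_unit_cell)
  then show ?thesis
    using cost_unit_cell_le[of "x - y + z"] that[of z] by (simp add: algebra_simps)
qed

definition admissible :: "(real^'n \<Rightarrow> real) \<Rightarrow> bool" where
  "admissible v \<longleftrightarrow> lattice_periodic v \<and> continuous_on UNIV v"

lemma admissible_periodic: "admissible v \<Longrightarrow> z \<in> integer_lattice \<Longrightarrow> v (x + z) = v x"
  by (simp add: admissible_def lattice_periodic_def)

lemma maximizers_near:
  assumes "admissible v" "x \<in> maximizers v y"
  shows "cost (x - y) \<le> cell_bound" "norm (x - y) \<le> radius"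
proof -
  obtain z where z: "z \<in> integer_lattice" "cost (x + z - y) \<le> cell_bound"
    by (rule lattice_translate_near)
  have "- cost (x + z - y) - v (x + z) \<le> - cost (x - y) - v x"
    using assms(2) unfolding maximizers_def by blast
  then show "cost (x - y) \<le> cell_bound"
    using z admissible_periodic[OF assms(1) z(1)] by simp
  then show "norm (x - y) \<le> radius" by (rule radius(2))
qed

text \<open>A point outside the ball of radius \<open>radius\<close> loses to one of its lattice translates inside, so the
  maximum over the compact ball is a global one.\<close>

lemma maximizers_nonempty:
  assumes v: "admissible v"
  shows "maximizers v y \<noteq> {}"
proof -
  have "continuous_on (cball y radius) (\<lambda>x. - cost (x - y) - v x)"
    using v unfolding admissible_def
    by (intro continuous_intros) (auto intro: continuous_on_subset)
  moreover have "cball y radius \<noteq> {}"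
    using radius(1) by simp
  ultimately obtain x where x: "\<And>x'. x' \<in> cball y radius \<Longrightarrow> - cost (x' - y) - v x' \<le> - cost (x - y) - v x"
    using continuous_attains_sup[OF compact_cball] by blast
  have "- cost (x' - y) - v x' \<le> - cost (x - y) - v x" for x'
  proof (cases "x' \<in> cball y radius")
    case False
    obtain z where z: "z \<in> integer_lattice" "cost (x' + z - y) \<le> cell_bound"
      by (rule lattice_translate_near)
    have "cell_bound < cost (x' - y)"
      using False radius(2)[of "x' - y"] by (metis dist_norm dist_commute mem_cball not_le)
    moreover have "x' + z \<in> cball y radius"
      using radius(2)[OF z(2)] by (simp add: dist_norm norm_minus_commute)
    ultimately show ?thesis
      using x[of "x' + z"] z(2) admissible_periodic[OF v z(1), of x'] by linarith
  qed (rule x)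
  then show ?thesis unfolding maximizers_def by blast
qed

lemma transform_eq:
  assumes "x \<in> maximizers v y"
  shows "transform v y = - cost (x - y) - v x"
  unfolding transform_def
  using assms by (intro cSup_eq_maximum) (auto simp: maximizers_def)

lemma transform_ge:
  assumes "admissible v"
  shows "- cost (x - y) - v x \<le> transform v y"
  using maximizers_nonempty[OF assms, of y] transform_eq[of _ v y] unfolding maximizers_def by fastforce

lemma maximizers_iff:
  assumes "admissible v"
  shows "x \<in> maximizers v y \<longleftrightarrow> transform v y = - cost (x - y) - v x"
proof
  assume "transform v y = - cost (x - y) - v x"
  then show "x \<in> maximizers v y"
    using transform_ge[OF assms, of _ y] by (simp add: maximizers_def)
qed (rule transform_eq)

lemma transform_le:
  assumes "admissible v" "\<And>x. - cost (x - y) - v x \<le> K"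
  shows "transform v y \<le> K"
  using maximizers_nonempty[OF assms(1), of y] transform_eq[of _ v y] assms(2) by fastforce

lemma maximizers_translate:
  assumes v: "admissible v" and z: "z \<in> integer_lattice" and x: "x \<in> maximizers v y"
  shows "x + z \<in> maximizers v (y + z)"
  unfolding maximizers_def
proof (intro CollectI allI)
  fix x'
  have "- cost (x' - z - y) - v (x' - z) \<le> - cost (x - y) - v x"
    using x unfolding maximizers_def by blast
  moreover have "v (x' - z) = v x'"
    using admissible_periodic[OF v z, of "x' - z"] by simp
  ultimately show "- cost (x' - (y + z)) - v x' \<le> - cost (x + z - (y + z)) - v (x + z)"
    using admissible_periodic[OF v z, of x] by (simp add: algebra_simps)
qed

lemma transform_periodic:
  assumes v: "admissible v"
  shows "lattice_periodic (transform v)"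
  unfolding lattice_periodic_def
proof (intro allI ballI)
  fix y and z :: "real^'n" assume z: "z \<in> integer_lattice"
  obtain x where x: "x \<in> maximizers v y"
    using maximizers_nonempty[OF v] by blast
  show "transform v (y + z) = transform v y"
    using transform_eq[OF x] transform_eq[OF maximizers_translate[OF v z x]]
      admissible_periodic[OF v z, of x] by simp
qed

definition lipschitz_bound :: real where
  "lipschitz_bound = onorm ((*v) A) * (radius + 1)"

lemma lipschitz_bound_nonneg: "0 \<le> lipschitz_bound"
  unfolding lipschitz_bound_def using radius(1)
  by (intro mult_nonneg_nonneg onorm_pos_le matrix_vector_mul_bounded_linear) auto

text \<open>A maximizer for \<open>a\<close> is a competitor for \<open>b\<close>, so the increment is at most a difference of costs, and
  the maximizer is at a bounded distance from \<open>a\<close>. The constant does not depend on \<open>v\<close>, which makes the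
  set of all transforms equicontinuous.\<close>

lemma transform_lipschitz:
  assumes v: "admissible v" and near: "norm (y' - y) \<le> 1"
  shows "\<bar>transform v y' - transform v y\<bar> \<le> lipschitz_bound * norm (y' - y)"
proof -
  have one_sided: "transform v a - transform v b \<le> lipschitz_bound * norm (b - a)"
    if near: "norm (b - a) \<le> 1" for a b
  proof -
    obtain x where x: "x \<in> maximizers v a"
      using maximizers_nonempty[OF v] by blast
    define w d where "w = x - a" and "d = b - a"
    have "transform v a - transform v b \<le> cost (w - d) - cost w"
      using transform_eq[OF x] transform_ge[OF v, of x b] by (simp add: w_def d_def)
    also have "\<dots> = (1/2) * (d \<bullet> (A *v (d - 2 *\<^sub>R w)))"
      unfolding cost_diff using inner_A_commute[of w d]
      by (simp add: cost_def matrix_vector_mult_diff_distrib matrix_vector_mult_scaleR inner_diff_right)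
    also have "\<dots> \<le> (1/2) * (norm d * norm (A *v (d - 2 *\<^sub>R w)))"
      using norm_cauchy_schwarz[of d "A *v (d - 2 *\<^sub>R w)"] by simp
    also have "\<dots> \<le> (1/2) * (norm d * (onorm ((*v) A) * (2 * (radius + 1))))"
    proof -
      have "norm (d - 2 *\<^sub>R w) \<le> 2 * (radius + 1)"
        using norm_triangle_ineq4[of d "2 *\<^sub>R w"] near maximizers_near(2)[OF v x]
        by (simp add: w_def d_def)
      then have "onorm ((*v) A) * norm (d - 2 *\<^sub>R w) \<le> onorm ((*v) A) * (2 * (radius + 1))"
        by (intro mult_left_mono onorm_pos_le matrix_vector_mul_bounded_linear)
      then have "norm (A *v (d - 2 *\<^sub>R w)) \<le> onorm ((*v) A) * (2 * (radius + 1))"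
        using onorm[OF matrix_vector_mul_bounded_linear, of A "d - 2 *\<^sub>R w"] by linarith
      then show ?thesis
        by (intro mult_left_mono) auto
    qed
    also have "\<dots> = lipschitz_bound * norm (b - a)"
      by (simp add: lipschitz_bound_def d_def algebra_simps)
    finally show ?thesis .
  qed
  show ?thesis
    using one_sided[of y y'] one_sided[of y' y] near by (simp add: norm_minus_commute abs_le_iff)
qed

lemma continuous_of_local_lipschitz:
  fixes f :: "real^'n \<Rightarrow> real"
  assumes "\<And>x y. norm (y - x) \<le> 1 \<Longrightarrow> \<bar>f y - f x\<bar> \<le> L * norm (y - x)"
  shows "continuous_on UNIV f"
proof (rule continuous_at_imp_continuous_on, intro ballI)
  fix x :: "real^'n"
  have "((\<lambda>y. f y - f x) \<longlongrightarrow> 0) (at x)"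
  proof (rule Lim_null_comparison)
    have "\<forall>\<^sub>F y in at x. dist y x < 1"
      by (rule eventually_at_ball'[THEN eventually_mono]) (auto simp: dist_commute)
    then show "\<forall>\<^sub>F y in at x. norm (f y - f x) \<le> L * norm (y - x)"
      by eventually_elim (use assms in \<open>auto simp: dist_norm\<close>)
    show "((\<lambda>y. L * norm (y - x)) \<longlongrightarrow> 0) (at x)"
      by (auto intro!: tendsto_eq_intros)
  qed
  then show "isCont f x"
    by (simp add: isCont_def Lim_null[symmetric])
qed

lemma admissible_transform: "admissible v \<Longrightarrow> admissible (transform v)"
  using transform_periodic transform_lipschitz
  by (auto simp: admissible_def intro!: continuous_of_local_lipschitz[of _ lipschitz_bound])

lemma transform_transform_le:
  assumes v: "admissible v"
  shows "transform (transform v) x \<le> v x"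
  using transform_ge[OF v, of x] cost_minus_commute
  by (intro transform_le admissible_transform v) (fastforce simp: algebra_simps)

lemma transform_transform_transform:
  assumes v: "admissible v"
  shows "transform (transform (transform v)) = transform v"
proof (rule ext, rule antisym)
  fix y
  show "transform (transform (transform v)) y \<le> transform v y"
    by (intro transform_transform_le admissible_transform v)
  obtain x where x: "x \<in> maximizers v y"
    using maximizers_nonempty[OF v] by blast
  have "transform v y \<le> - cost (x - y) - transform (transform v) x"
    using transform_eq[OF x] transform_transform_le[OF v, of x] by simp
  also have "\<dots> \<le> transform (transform (transform v)) y"
    by (intro transform_ge admissible_transform v)
  finally show "transform v y \<le> transform (transform (transform v)) y" .
qed

lemma maximizers_limit:
  assumes v: "admissible v" and x: "x \<longlonglongrightarrow> a" and y: "y \<longlonglongrightarrow> b"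
    and m: "\<And>k. x k \<in> maximizers v (y k)"
  shows "a \<in> maximizers v b"
  unfolding maximizers_def
proof (intro CollectI allI)
  fix x'
  have cv: "continuous_on UNIV v" using v by (simp add: admissible_def)
  have cc: "isCont cost w" for w
    using continuous_on_cost[OF continuous_on_id, of UNIV] by (simp add: continuous_on_eq_continuous_at)
  have "(\<lambda>k. - cost (x' - y k) - v x') \<longlonglongrightarrow> - cost (x' - b) - v x'"
    by (intro tendsto_intros isCont_tendsto_compose[OF cc] y)
  moreover have "(\<lambda>k. - cost (x k - y k) - v (x k)) \<longlonglongrightarrow> - cost (a - b) - v a"
    using cv by (intro tendsto_intros isCont_tendsto_compose[OF cc]  x y continuous_on_tendsto_compose[OF cv]) auto
  ultimately show "- cost (x' - b) - v x' \<le> - cost (a - b) - v a"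
    by (rule LIMSEQ_le) (use m in \<open>auto simp: maximizers_def\<close>)
qed

end

section \<open>Points with several maximizers\<close>

text \<open>The translates of a bounded piece of \<open>S\<close> by distinct multiples of \<open>d\<close> are disjoint, have equal measure,
  and infinitely many of them stay in a bounded set.\<close>

lemma null_set_of_sparse_direction:
  fixes S :: "'a::euclidean_space set"
  assumes S: "S \<in> sets borel" and sparse: "\<And>y t. y \<in> S \<Longrightarrow> 0 < t \<Longrightarrow> y + t *\<^sub>R d \<notin> S"
  shows "S \<in> null_sets lborel"
proof -
  have "emeasure lborel (S \<inter> cball 0 (real n)) = 0" for n
  proof -
    define T where "T = S \<inter> cball 0 (real n)"
    have T[measurable]: "T \<in> sets borel"
      unfolding T_def using S by simp
    define c where "c k = inverse (real (Suc k)) *\<^sub>R d" for k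
    define F where "F k = (+) (- c k) -` T" for k
    have F: "F k \<in> sets borel" for k
      using measurable_sets[of "(+) (- c k)" borel borel T] T by (simp add: F_def)
    have eF: "emeasure lborel (F k) = emeasure lborel T" for k
    proof -
      have "emeasure lborel T = emeasure (distr lborel borel ((+) (- c k))) T"
        by (simp only: lborel_distr_plus)
      also have "\<dots> = emeasure lborel (F k)"
        by (subst emeasure_distr) (auto simp: F_def T)
      finally show ?thesis by simp
    qed
    have disj: "disjoint_family F"
    proof -
      have False if "x \<in> F i" "x \<in> F j" "i < j" for x i j
      proof -
        have 1: "x - c i \<in> S" "x - c j \<in> S"
          using that by (auto simp: F_def T_def)
        have "inverse (real (Suc i)) - inverse (real (Suc j)) > 0"
          using \<open>i < j\<close> by (simp add: less_imp_inverse_less)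
        from sparse[OF 1(1) this] have "x - c j \<notin> S"
          by (simp add: c_def algebra_simps)
        with 1 show False by simp
      qed
      then show ?thesis
        unfolding disjoint_family_on_def by (metis disjoint_iff linorder_neqE_nat)
    qed
    have sub: "F k \<subseteq> cball 0 (real n + norm d)" for k
    proof
      fix x assume "x \<in> F k"
      then have "norm (x - c k) \<le> real n"
        by (simp add: F_def T_def)
      moreover have "norm (c k) \<le> norm d"
        by (simp add: c_def mult_left_le_one_le inverse_le_1_iff)
      ultimately have "norm x \<le> real n + norm d"
        using norm_triangle_ineq[of "x - c k" "c k"] by simp
      then show "x \<in> cball 0 (real n + norm d)" by simp
    qed
    have Tfin: "emeasure lborel T < \<infinity>"
      by (rule emeasure_bounded_finite) (auto simp: T_def)
    then have Tm: "emeasure lborel T = ennreal (measure lborel T)"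
      by (simp add: emeasure_eq_ennreal_measure less_top)
    have bfin: "emeasure lborel (cball (0::'a) (real n + norm d)) < \<infinity>"
      by (rule emeasure_bounded_finite) auto
    have "real N * measure lborel T \<le> measure lborel (cball (0::'a) (real n + norm d))" for N
    proof -
      have "of_nat N * emeasure lborel T = (\<Sum>k<N. emeasure lborel (F k))"
        by (simp add: eF)
      also have "\<dots> = emeasure lborel (\<Union>k<N. F k)"
        using disj F by (intro sum_emeasure) (auto simp: disjoint_family_on_def)
      also have "\<dots> \<le> emeasure lborel (cball (0::'a) (real n + norm d))"
        using sub by (intro emeasure_mono) auto
      finally have "ennreal (real N * measure lborel T)
          \<le> ennreal (measure lborel (cball (0::'a) (real n + norm d)))"
        using bfin by (simp add: Tm emeasure_eq_ennreal_measure less_top ennreal_mult ennreal_of_nat_eq_real_of_nat)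
      then show ?thesis
        by (subst (asm) ennreal_le_iff) auto
    qed
    then have "measure lborel T \<le> 0"
      using reals_Archimedean3[of "measure lborel T"] by (meson linorder_not_le)
    then show ?thesis
      using Tm unfolding T_def by (simp add: ennreal_neg)
  qed
  then have "(\<Union>n. S \<inter> cball 0 (real n)) \<in> null_sets lborel"
    using S by (intro null_sets_UN) (auto simp: null_sets_def)
  moreover have "(\<Union>n. S \<inter> cball 0 (real n)) = S"
  proof (intro set_eqI iffI)
    fix x assume "x \<in> S"
    moreover obtain n :: nat where "norm x \<le> real n"
      using real_arch_simple by blast
    ultimately show "x \<in> (\<Union>n. S \<inter> cball 0 (real n))" by auto
  qed blast
  ultimately show ?thesis by simp
qed

context pos_def_matrix
begin

text \<open>In the sum of the two optimality inequalities only the mixed terms of the costs survive.\<close>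

lemma maximizers_monotone:
  assumes "x \<in> maximizers v y" "x' \<in> maximizers v y'"
  shows "0 \<le> (x' - x) \<bullet> (A *v (y' - y))"
proof -
  have "- cost (x' - y) - v x' \<le> - cost (x - y) - v x"
       "- cost (x - y') - v x \<le> - cost (x' - y') - v x'"
    using assms unfolding maximizers_def by blast+
  then show ?thesis
    by (simp add: cost_diff matrix_vector_mult_diff_distrib inner_diff_left inner_diff_right)
qed

lemma maximizers_subsequence_limit:
  assumes v: "admissible v" and lim: "y \<longlonglongrightarrow> b" and x: "\<And>k. x k \<in> maximizers v (y k)"
  obtains a r where "strict_mono r" "(x \<circ> r) \<longlonglongrightarrow> a" "a \<in> maximizers v b"
proof -
  have "bounded (range y)"
    using lim convergent_imp_bounded by blast
  then obtain C where C: "\<And>k. norm (y k) \<le> C"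
    unfolding bounded_iff by blast
  have "norm (x k) \<le> C + radius" for k
    using C[of k] maximizers_near(2)[OF v x[of k]] norm_triangle_ineq[of "x k - y k" "y k"] by simp
  then have "bounded (range x)"
    unfolding bounded_iff by blast
  then obtain a r where r: "strict_mono r" "(x \<circ> r) \<longlonglongrightarrow> a"
    using bounded_imp_convergent_subsequence by blast
  have "a \<in> maximizers v b"
    by (rule maximizers_limit[OF v r(2) LIMSEQ_subseq_LIMSEQ[OF lim r(1)]]) (simp add: x)
  with r show ?thesis by (rule that)
qed

lemma closed_maximizers_meet:
  assumes v: "admissible v" and E: "closed E"
  shows "closed {y. maximizers v y \<inter> E \<noteq> {}}"
  unfolding closed_sequential_limits
proof (intro allI impI, elim conjE)
  fix y b assume y: "\<forall>k. y k \<in> {y. maximizers v y \<inter> E \<noteq> {}}" and lim: "y \<longlonglongrightarrow> b"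
  then have "\<forall>k. \<exists>x. x \<in> maximizers v (y k) \<inter> E"
    by blast
  then obtain x where x: "\<And>k. x k \<in> maximizers v (y k)" "\<And>k. x k \<in> E"
    by (metis IntD1 IntD2)
  obtain a r where r: "strict_mono r" "(x \<circ> r) \<longlonglongrightarrow> a" "a \<in> maximizers v b"
    using maximizers_subsequence_limit[OF v lim x(1)] by blast
  have "a \<in> E"
    by (rule closed_sequentially[OF E _ r(2)]) (simp add: x)
  with r(3) show "b \<in> {y. maximizers v y \<inter> E \<noteq> {}}" by blast
qed

definition ambiguous :: "(real^'n \<Rightarrow> real) \<Rightarrow> (real^'n) set" where
  "ambiguous v = {y. \<exists>x\<in>maximizers v y. \<exists>x'\<in>maximizers v y. x \<noteq> x'}"

text \<open>Slabs with rational \<open>r < s\<close> exhaust the ambiguous set by countably many closed sets.\<close>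

definition ambiguous_slab where
  "ambiguous_slab v i r s =
     {y. maximizers v y \<inter> {x. x $ i \<le> r} \<noteq> {}} \<inter> {y. maximizers v y \<inter> {x. s \<le> x $ i} \<noteq> {}}"

lemma ambiguous_eq_slabs:
  "ambiguous v = (\<Union>i. \<Union>(r, s)\<in>{(r, s). r \<in> \<rat> \<and> s \<in> \<rat> \<and> r < s}. ambiguous_slab v i r s)"
proof (intro set_eqI iffI)
  fix y assume "y \<in> ambiguous v"
  then obtain x x' where x: "x \<in> maximizers v y" "x' \<in> maximizers v y" "x \<noteq> x'"
    unfolding ambiguous_def by blast
  then obtain i where i: "x $ i \<noteq> x' $ i"
    by (auto simp: vec_eq_iff)
  obtain a b where ab: "a \<in> maximizers v y" "b \<in> maximizers v y" "a $ i < b $ i"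
    using x i by (metis linorder_neqE_linordered_idom)
  obtain r where r: "r \<in> \<rat>" "a $ i < r" "r < b $ i"
    using Rats_dense_in_real[OF ab(3)] by blast
  obtain s where s: "s \<in> \<rat>" "r < s" "s < b $ i"
    using Rats_dense_in_real[OF r(3)] by blast
  have "y \<in> ambiguous_slab v i r s"
    unfolding ambiguous_slab_def using ab r s by (auto intro: less_imp_le)
  then show "y \<in> (\<Union>i. \<Union>(r, s)\<in>{(r, s). r \<in> \<rat> \<and> s \<in> \<rat> \<and> r < s}. ambiguous_slab v i r s)"
    using r s by blast
next
  fix y assume "y \<in> (\<Union>i. \<Union>(r, s)\<in>{(r, s). r \<in> \<rat> \<and> s \<in> \<rat> \<and> r < s}. ambiguous_slab v i r s)"
  then obtain i r s where "r < s" "y \<in> ambiguous_slab v i r s"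
    by blast
  then show "y \<in> ambiguous v"
    unfolding ambiguous_slab_def ambiguous_def by (auto simp: set_eq_iff) (metis leD less_le_trans)
qed

lemma countable_rat_pairs: "countable {(r, s). r \<in> \<rat> \<and> s \<in> \<rat> \<and> r < (s::real)}"
proof (rule countable_subset)
  show "{(r, s). r \<in> \<rat> \<and> s \<in> \<rat> \<and> r < (s::real)} \<subseteq> \<rat> \<times> \<rat>" by blast
  show "countable ((\<rat> :: real set) \<times> (\<rat> :: real set))"
    by (intro countable_SIGMA countable_rat)
qed

text \<open>Let \<open>A d = e\<^sub>i\<close>. By monotonicity the \<open>i\<close>-th coordinate of maximizers does not decrease along \<open>d\<close>. At a
  point of the slab it reaches \<open>s\<close>, so further along \<open>d\<close> it can no longer be \<open>r\<close> or less.\<close>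

lemma ambiguous_slab_null:
  assumes v: "admissible v" and "r < s"
  shows "ambiguous_slab v i r s \<in> null_sets lborel"
proof -
  obtain d where d: "A *v d = axis i 1"
    using surj_A by (metis surjD)
  show ?thesis
  proof (rule null_set_of_sparse_direction)
    have "closed (ambiguous_slab v i r s)"
      unfolding ambiguous_slab_def
      by (intro closed_Int closed_maximizers_meet v closed_halfspace_component_le_cart closed_halfspace_component_ge_cart)
    then show "ambiguous_slab v i r s \<in> sets borel" by simp
    fix y t assume y: "y \<in> ambiguous_slab v i r s" and t: "0 < (t::real)"
    show "y + t *\<^sub>R d \<notin> ambiguous_slab v i r s"
    proof
      assume "y + t *\<^sub>R d \<in> ambiguous_slab v i r s"
      then obtain x' where x': "x' \<in> maximizers v (y + t *\<^sub>R d)" "x' $ i \<le> r"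
        unfolding ambiguous_slab_def by auto
      obtain x where x: "x \<in> maximizers v y" "s \<le> x $ i"
        using y unfolding ambiguous_slab_def by auto
      have "0 \<le> t * (x' $ i - x $ i)"
        using maximizers_monotone[OF x(1) x'(1)] d
        by (simp add: matrix_vector_mult_scaleR inner_axis)
      with t have "x $ i \<le> x' $ i"
        by (simp add: zero_le_mult_iff)
      with x x' \<open>r < s\<close> show False by simp
    qed
  qed
qed

lemma ambiguous_null:
  assumes v: "admissible v"
  shows "ambiguous v \<in> null_sets lborel"
proof -
  have "(\<Union>(r, s)\<in>{(r, s). r \<in> \<rat> \<and> s \<in> \<rat> \<and> r < s}. ambiguous_slab v i r s) \<in> null_sets lborel" for i
    using ambiguous_slab_null[OF v] by (intro null_sets_UN'[OF countable_rat_pairs]) auto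
  then show ?thesis
    unfolding ambiguous_eq_slabs by (intro null_sets_UN'[of UNIV]) auto
qed

lemma ambiguous_borel: "admissible v \<Longrightarrow> ambiguous v \<in> sets borel"
  using ambiguous_null by (simp add: null_sets_def)

lemma ambiguous_translate:
  assumes v: "admissible v" and z: "z \<in> integer_lattice"
  shows "y + z \<in> ambiguous v \<longleftrightarrow> y \<in> ambiguous v"
proof -
  have *: "y + z \<in> ambiguous v" if "y \<in> ambiguous v" "z \<in> integer_lattice" for y z
    using that maximizers_translate[OF v] unfolding ambiguous_def
    by (auto) (metis add_right_cancel)
  show ?thesis
    using *[of y z] *[of "y + z" "- z"] z integer_lattice_uminus by auto
qed

text \<open>The value \<open>y\<close> on the null set of ambiguous points keeps the map Borel and makes it commute with
  lattice translations at every point, so that preimages of fundamental domains are fundamental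
  domains without exceptional sets.\<close>

definition optimal_map :: "(real^'n \<Rightarrow> real) \<Rightarrow> real^'n \<Rightarrow> real^'n" where
  "optimal_map v y = (if y \<in> ambiguous v then y else (SOME x. x \<in> maximizers v y))"

lemma optimal_map_ambiguous: "y \<in> ambiguous v \<Longrightarrow> optimal_map v y = y"
  by (simp add: optimal_map_def)

lemma maximizers_eq_optimal_map:
  assumes v: "admissible v" and y: "y \<notin> ambiguous v"
  shows "maximizers v y = {optimal_map v y}"
proof -
  have "optimal_map v y \<in> maximizers v y"
    using maximizers_nonempty[OF v, of y] y by (simp add: optimal_map_def some_in_eq)
  then show ?thesis
    using y unfolding ambiguous_def by blast
qed

lemma optimal_map_translate:
  assumes v: "admissible v" and z: "z \<in> integer_lattice"
  shows "optimal_map v (y + z) = optimal_map v y + z"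
proof (cases "y \<in> ambiguous v")
  case True
  then show ?thesis
    using ambiguous_translate[OF v z] by (simp add: optimal_map_ambiguous)
next
  case False
  then have "optimal_map v y + z \<in> maximizers v (y + z)"
    using maximizers_eq_optimal_map[OF v] by (intro maximizers_translate v z) auto
  then show ?thesis
    using False ambiguous_translate[OF v z] maximizers_eq_optimal_map[OF v, of "y + z"] by auto
qed

lemma optimal_map_borel:
  assumes v: "admissible v"
  shows "optimal_map v \<in> borel_measurable borel"
proof (rule borel_measurableI)
  fix U :: "(real^'n) set" assume U: "open U"
  have "optimal_map v -` U = ({y. maximizers v y \<inter> - U \<noteq> {}} \<union> ambiguous v) \<inter> (ambiguous v \<inter> U)
      \<union> (- {y. maximizers v y \<inter> - U \<noteq> {}} - ambiguous v)"
  proof (intro set_eqI iffI)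
    fix y
    show "y \<in> optimal_map v -` U" if "y \<in> ({y. maximizers v y \<inter> - U \<noteq> {}} \<union> ambiguous v) \<inter> (ambiguous v \<inter> U)
      \<union> (- {y. maximizers v y \<inter> - U \<noteq> {}} - ambiguous v)"
      using that maximizers_eq_optimal_map[OF v, of y] by (auto simp: optimal_map_ambiguous)
    show "y \<in> ({y. maximizers v y \<inter> - U \<noteq> {}} \<union> ambiguous v) \<inter> (ambiguous v \<inter> U)
      \<union> (- {y. maximizers v y \<inter> - U \<noteq> {}} - ambiguous v)" if "y \<in> optimal_map v -` U"
      using that maximizers_eq_optimal_map[OF v, of y]
      by (cases "y \<in> ambiguous v") (auto simp: optimal_map_ambiguous)
  qed
  moreover have "{y. maximizers v y \<inter> - U \<noteq> {}} \<in> sets borel"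
    using U by (intro borel_closed closed_maximizers_meet v) auto
  ultimately show "optimal_map v -` U \<inter> space borel \<in> sets borel"
    using ambiguous_borel[OF v] U by simp
qed

lemma fundamental_domain_optimal_preimage:
  assumes v: "admissible v"
  shows "fundamental_domain (optimal_map v -` unit_cell)"
proof -
  have "optimal_map v -` unit_cell \<in> sets borel"
    using measurable_sets[OF optimal_map_borel[OF v] unit_cell_borel] by simp
  moreover have "\<exists>!z. z \<in> integer_lattice \<and> optimal_map v y + z \<in> unit_cell" for y
    using fundamental_domain_unit_cell unfolding fundamental_domain_def by blast
  ultimately show ?thesis
    unfolding fundamental_domain_def using optimal_map_translate[OF v]
    by (simp cong: conj_cong)
qed

end

section \<open>Periodic measures and their trace on the unit cell\<close>

lemma closed_integer_lattice: "closed (integer_lattice :: (real^'n) set)"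
proof -
  have "closed {z :: real^'n. \<forall>i. z $ i \<in> \<int>}"
  proof (rule closed_Collect_all)
    fix i
    have "closed ((\<lambda>z :: real^'n. z $ i) -` \<int>)"
      by (intro closed_vimage closed_Ints continuous_intros)
    then show "closed {z :: real^'n. z $ i \<in> \<int>}"
      by (simp add: vimage_def)
  qed
  then show ?thesis by (simp add: integer_lattice_def)
qed

lemma emeasure_fundamental_domain:
  assumes "sets \<nu> = sets borel" "lattice_periodic_measure \<nu>" "fundamental_domain D"
  shows "emeasure \<nu> D = emeasure \<nu> unit_cell"
proof -
  have D: "D \<in> sets \<nu>" "unit_cell \<in> sets \<nu>"
    using assms by (auto simp: fundamental_domain_def)
  show ?thesis
    using nn_integral_fundamental_domain_cong[OF assms fundamental_domain_unit_cell, of "\<lambda>_. 1"] D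
    by simp
qed

text \<open>A compact set inside some unit box is the part in that box of a closed periodic set, so
  the hypothesis determines the measures of such compact sets. They are stable under intersection and
  generate the Borel sets.\<close>

lemma periodic_measure_eqI:
  fixes \<nu> \<nu>' :: "(real^'n) measure"
  assumes sets: "sets \<nu> = sets borel" "sets \<nu>' = sets borel"
    and per: "lattice_periodic_measure \<nu>" "lattice_periodic_measure \<nu>'"
    and fin: "emeasure \<nu> unit_cell < \<infinity>"
    and eq: "\<And>C. closed C \<Longrightarrow> (\<And>x z. z \<in> integer_lattice \<Longrightarrow> x + z \<in> C \<longleftrightarrow> x \<in> C) \<Longrightarrow>
              emeasure \<nu> (C \<inter> unit_cell) = emeasure \<nu>' (C \<inter> unit_cell)"
  shows "\<nu> = \<nu>'"
proof -
  define D where "D a = {x :: real^'n. \<forall>i. a $ i \<le> x $ i \<and> x $ i < a $ i + 1}" for a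
  have D: "fundamental_domain (D a)" for a
    unfolding D_def by (rule fundamental_domain_box)
  have Db: "D a \<in> sets borel" for a
    using D by (simp add: fundamental_domain_def)
  define \<E> where "\<E> = {K. compact K \<and> (\<exists>a. K \<subseteq> D a)}"
  define Q where "Q z = cbox (\<chi> i. z $ i / 2) (\<chi> i. z $ i / 2 + 1/2)" for z :: "real^'n"
  have Q: "Q z \<in> \<E>" for z
    unfolding \<E>_def
  proof (intro CollectI conjI exI)
    show "compact (Q z)" by (simp add: Q_def)
    show "Q z \<subseteq> D (\<chi> i. z $ i / 2)"
    proof
      fix x assume x: "x \<in> Q z"
      have "z $ i / 2 \<le> x $ i \<and> x $ i < z $ i / 2 + 1" for i
        using x[unfolded Q_def mem_box_cart, rule_format, of i] by simp
      then show "x \<in> D (\<chi> i. z $ i / 2)"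
        unfolding D_def by simp
    qed
  qed
  have Qcover: "\<exists>z\<in>integer_lattice. x \<in> Q z" for x
  proof (rule bexI)
    have "of_int \<lfloor>2 * x $ i\<rfloor> / 2 \<le> x $ i \<and> x $ i \<le> of_int \<lfloor>2 * x $ i\<rfloor> / 2 + 1/2" for i
      by linarith
    then show "x \<in> Q (\<chi> i. of_int \<lfloor>2 * x $ i\<rfloor>)"
      unfolding Q_def by (simp add: mem_box_cart)
    show "(\<chi> i. of_int \<lfloor>2 * x $ i\<rfloor>) \<in> integer_lattice"
      by (simp add: integer_lattice_def)
  qed
  have gen: "sets borel = sigma_sets UNIV \<E>"
  proof (rule antisym)
    show "sigma_sets UNIV \<E> \<subseteq> sets borel"
      using sets.sigma_sets_subset[of \<E> borel] by (simp add: \<E>_def borel_compact subset_iff)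
    interpret S: sigma_algebra UNIV "sigma_sets UNIV \<E>"
      by (rule sigma_algebra_sigma_sets) simp
    have "F \<in> sigma_sets UNIV \<E>" if "closed F" for F :: "(real^'n) set"
    proof -
      have "F = (\<Union>z\<in>integer_lattice. F \<inter> Q z)"
        using Qcover by blast
      moreover have "F \<inter> Q z \<in> \<E>" for z
        using Q[of z] that unfolding \<E>_def by (auto intro: closed_Int_compact)
      ultimately show ?thesis
        using S.countable_UN'[OF countable_integer_lattice, of "\<lambda>z. F \<inter> Q z"] by (metis image_subset_iff sigma_sets.Basic)
    qed
    then show "sets borel \<subseteq> sigma_sets UNIV \<E>"
      unfolding borel_eq_closed by (auto intro!: sigma_sets_mono)
  qed
  \<comment> \<open>The half-integer boxes \<open>Q z\<close> are in \<open>\<E>\<close>: their sides are shorter than those of the half-open \<open>D a\<close>.\<close>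
  show ?thesis
  proof (rule measure_eqI_generator_eq_countable[where E = \<E> and \<Omega> = UNIV and A = "Q ` integer_lattice"])
    show "Int_stable \<E>"
      unfolding \<E>_def Int_stable_def by (auto intro: compact_Int)
    show "sets \<nu> = sigma_sets UNIV \<E>" "sets \<nu>' = sigma_sets UNIV \<E>"
      using sets gen by auto
    show "Q ` integer_lattice \<subseteq> \<E>" using Q by blast
    show "\<Union> (Q ` integer_lattice) = UNIV" using Qcover by blast
    show "countable (Q ` integer_lattice)" by (intro countable_image countable_integer_lattice)
    show "emeasure \<nu> K \<noteq> \<infinity>" if KQ: "K \<in> Q ` integer_lattice" for K
    proof -
      obtain a where "K \<subseteq> D a" using Q KQ unfolding \<E>_def by blast
      then have "emeasure \<nu> K \<le> emeasure \<nu> (D a)"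
        using sets Db by (intro emeasure_mono) auto
      also have "\<dots> < \<infinity>"
        using fin emeasure_fundamental_domain[OF sets(1) per(1) D] by simp
      finally show ?thesis by simp
    qed
    fix K assume "K \<in> \<E>"
    then obtain a where K: "compact K" "K \<subseteq> D a"
      unfolding \<E>_def by blast
    \<comment> \<open>The lattice translates of \<open>K\<close> form a closed periodic set that meets \<open>D a\<close> in \<open>K\<close> only.\<close>
    define C where "C = (\<Union>x\<in>K. \<Union>y\<in>integer_lattice. {x + y})"
    have C: "closed C"
      unfolding C_def by (rule compact_closed_sums[OF K(1) closed_integer_lattice])
    have Cper1: "x + z \<in> C" if x: "x \<in> C" and z: "z \<in> integer_lattice" for x z
    proof -
      obtain k y where "k \<in> K" "y \<in> integer_lattice" "x = k + y"
        using x unfolding C_def by blast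
      then have "y + z \<in> integer_lattice" "x + z = k + (y + z)"
        using integer_lattice_add z by (auto simp: add.assoc)
      with \<open>k \<in> K\<close> show ?thesis
        unfolding C_def by blast
    qed
    have Cper: "x + z \<in> C \<longleftrightarrow> x \<in> C" if "z \<in> integer_lattice" for x z
      using Cper1[of x z] Cper1[of "x + z" "- z"] that integer_lattice_uminus by auto
    have CD: "C \<inter> D a = K"
    proof
      show "K \<subseteq> C \<inter> D a"
        using K(2) by (force simp: C_def integer_lattice_def)
      show "C \<inter> D a \<subseteq> K"
      proof
        fix w assume "w \<in> C \<inter> D a"
        then obtain x y where w: "w = x + y" "x \<in> K" "y \<in> integer_lattice" "x + y \<in> D a"
          unfolding C_def by auto
        have "\<exists>!z. z \<in> integer_lattice \<and> x + z \<in> D a"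
          using D unfolding fundamental_domain_def by blast
        moreover have "x + 0 \<in> D a" "0 \<in> integer_lattice"
          using w(2) K(2) by (auto simp: integer_lattice_def)
        ultimately have "y = 0" using w by blast
        then show "w \<in> K" using w by simp
      qed
    qed
    have trace: "emeasure \<rho> K = emeasure \<rho> (C \<inter> unit_cell)"
      if "sets \<rho> = sets borel" "lattice_periodic_measure \<rho>" for \<rho>
    proof -
      have m: "C \<inter> D a \<in> sets \<rho>" "C \<inter> unit_cell \<in> sets \<rho>"
        using that C Db by auto
      have Cm: "(indicator C :: _ \<Rightarrow> ennreal) \<in> borel_measurable borel"
        using C by simp
      have "(\<integral>\<^sup>+x. indicator C x * indicator (D a) x \<partial>\<rho>) = (\<integral>\<^sup>+x. indicator C x * indicator unit_cell x \<partial>\<rho>)"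
        using nn_integral_fundamental_domain_cong[OF that D fundamental_domain_unit_cell Cm, of a]
        by (simp add: indicator_def Cper)
      then show ?thesis
        using m by (simp add: indicator_inter_arith[symmetric] CD)
    qed
    show "emeasure \<nu> K = emeasure \<nu>' K"
      using trace[OF sets(1) per(1)] trace[OF sets(2) per(2)] eq[OF C Cper] by simp
  qed simp
qed

lemma lattice_periodic_lborel: "lattice_periodic_measure lborel"
  unfolding lattice_periodic_measure_def
proof (intro ballI)
  fix E :: "(real^'n) set" and z assume E: "E \<in> sets borel"
  have vim: "(\<lambda>x. x + z) ` E = (+) (- z) -` E"
    unfolding translate_eq_vimage by auto
  have "emeasure lborel E = emeasure (distr lborel borel ((+) (- z))) E"
    by (simp only: lborel_distr_plus)
  also have "\<dots> = emeasure lborel ((\<lambda>x. x + z) ` E)"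
    unfolding vim by (subst emeasure_distr) (auto simp: E)
  finally show "emeasure lborel ((\<lambda>x. x + z) ` E) = emeasure lborel E" by simp
qed

lemma emeasure_lborel_unit_cell: "emeasure lborel (unit_cell :: (real^'n) set) = 1"
proof (rule antisym)
  have one: "(1::real^'n) \<bullet> b = 1" if "b \<in> Basis" for b
    using that by (auto simp: Basis_vec_def inner_axis)
  have "emeasure lborel (unit_cell :: (real^'n) set) \<le> emeasure lborel (cbox 0 (1::real^'n))"
    by (intro emeasure_mono unit_cell_subset_cbox) auto
  also have "\<dots> = 1"
    by (subst emeasure_lborel_cbox) (auto simp: one)
  finally show "emeasure lborel (unit_cell :: (real^'n) set) \<le> 1" .
  have "1 = emeasure lborel (box 0 (1::real^'n))"
    by (subst emeasure_lborel_box) (auto simp: one)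
  also have "\<dots> \<le> emeasure lborel (unit_cell :: (real^'n) set)"
    by (intro emeasure_mono) (auto simp: unit_cell_def mem_box_cart less_imp_le)
  finally show "1 \<le> emeasure lborel (unit_cell :: (real^'n) set)" .
qed

section \<open>Alexandrov solutions as transport maps\<close>

text \<open>The formula is multiplicative in \<open>f\<close>, so elementary maps suffice. Transpositions of coordinates and
  shears preserve the volume of boxes, hence of all measurable sets, and have determinant of modulus 1:
  a transposition is an involution, a shear adds one row of the identity matrix to another.\<close>

lemma measure_linear_image_vec:
  fixes f :: "real^'n \<Rightarrow> real^'n"
  assumes lin: "linear f" and S: "S \<in> lmeasurable"
  shows "f ` S \<in> lmeasurable \<and> measure lebesgue (f ` S) = \<bar>det (matrix f)\<bar> * measure lebesgue S"
proof -
  have boxes: "\<forall>S\<in>lmeasurable. g ` S \<in> lmeasurable \<and> measure lebesgue (g ` S) = \<bar>det (matrix g)\<bar> * measure lebesgue S"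
    if "linear g" "\<bar>det (matrix g)\<bar> = 1"
      "\<And>a b. cbox a b \<noteq> {} \<Longrightarrow> measure lebesgue (g ` cbox a b) = measure lebesgue (cbox a b)" for g :: "real^'n \<Rightarrow> real^'n"
  proof -
    have eq: "measure lebesgue (g ` cbox a b) = 1 * measure lebesgue (cbox a b)" for a b
      using that(3)[of a b] by (cases "cbox a b = {}") auto
    show ?thesis
    proof
      fix S :: "(real^'n) set" assume "S \<in> lmeasurable"
      from measure_linear_sufficient[OF that(1) this eq] that(2)
      show "g ` S \<in> lmeasurable \<and> measure lebesgue (g ` S) = \<bar>det (matrix g)\<bar> * measure lebesgue S"
        by (simp only: mult_1)
    qed
  qed
  have "\<forall>S\<in>lmeasurable. f ` S \<in> lmeasurable \<and> measure lebesgue (f ` S) = \<bar>det (matrix f)\<bar> * measure lebesgue S"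
  proof (rule induct_linear_elementary[OF lin])
    fix f g :: "real^'n \<Rightarrow> real^'n"
    assume fg: "linear f" "linear g"
      and f: "\<forall>S\<in>lmeasurable. f ` S \<in> lmeasurable \<and> measure lebesgue (f ` S) = \<bar>det (matrix f)\<bar> * measure lebesgue S"
      and g: "\<forall>S\<in>lmeasurable. g ` S \<in> lmeasurable \<and> measure lebesgue (g ` S) = \<bar>det (matrix g)\<bar> * measure lebesgue S"
    have "det (matrix (f \<circ> g)) = det (matrix f) * det (matrix g)"
      by (simp add: matrix_compose[OF fg(2,1)] det_mul)
    note d = this
    show "\<forall>S\<in>lmeasurable. (f \<circ> g) ` S \<in> lmeasurable \<and>
        measure lebesgue ((f \<circ> g) ` S) = \<bar>det (matrix (f \<circ> g))\<bar> * measure lebesgue S"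
    proof
      fix S :: "(real^'n) set" assume "S \<in> lmeasurable"
      then have gS: "g ` S \<in> lmeasurable" "measure lebesgue (g ` S) = \<bar>det (matrix g)\<bar> * measure lebesgue S"
        using g by auto
      show "(f \<circ> g) ` S \<in> lmeasurable \<and>
        measure lebesgue ((f \<circ> g) ` S) = \<bar>det (matrix (f \<circ> g))\<bar> * measure lebesgue S"
        using f[rule_format, OF gS(1)] gS(2) by (simp only: image_comp[symmetric] d abs_mult mult.assoc)
    qed
  next
    fix f :: "real^'n \<Rightarrow> real^'n" and i
    assume f: "linear f" "\<And>x. f x $ i = 0"
    then have "\<not> surj f"
      by (metis axis_index_axis surjD zero_neq_one axis_nth)
    then have ninj: "\<not> inj f"
      using f(1) linear_injective_imp_surjective by blast
    then have "det (matrix f) = 0"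
      using f(1) det_nz_iff_inj by blast
    moreover have "negligible (f ` S)" for S
      using negligible_linear_singular_image[OF f(1) ninj] .
    ultimately show "\<forall>S\<in>lmeasurable. f ` S \<in> lmeasurable \<and> measure lebesgue (f ` S) = \<bar>det (matrix f)\<bar> * measure lebesgue S"
      by (simp add: negligible_iff_measure)
  next
    fix c :: "'n \<Rightarrow> real"
    have "det (matrix (\<lambda>x. \<chi> i. c i * x $ i)) = prod c UNIV"
      by (subst det_diagonal) (auto simp: matrix_def axis_def)
    then show "\<forall>S\<in>lmeasurable. (\<lambda>x. \<chi> i. c i * x $ i) ` S \<in> lmeasurable \<and>
        measure lebesgue ((\<lambda>x. \<chi> i. c i * x $ i) ` S) = \<bar>det (matrix (\<lambda>x. \<chi> i. c i * x $ i))\<bar> * measure lebesgue S"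
      by (simp add: measurable_stretch measure_stretch)
  next
    fix m n :: 'n
    let ?h = "\<lambda>x::real^'n. \<chi> i. x $ Transposition.transpose m n i"
    show "\<forall>S\<in>lmeasurable. ?h ` S \<in> lmeasurable \<and> measure lebesgue (?h ` S) = \<bar>det (matrix ?h)\<bar> * measure lebesgue S"
    proof (rule boxes)
      show lin: "linear ?h"
        by (rule linearI) (auto simp: vec_eq_iff)
      have inv: "?h \<circ> ?h = id"
        by (auto simp: fun_eq_iff vec_eq_iff)
      have "det (matrix ?h) * det (matrix ?h) = det (matrix (?h \<circ> ?h))"
        by (simp add: matrix_compose[OF lin lin] det_mul)
      also have "\<dots> = 1"
        by (simp only: inv matrix_id det_I)
      finally show "\<bar>det (matrix ?h)\<bar> = 1"
        by (simp add: abs_square_eq_1[symmetric] power2_eq_square)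
      fix a b :: "real^'n" assume ne: "cbox a b \<noteq> {}"
      have "?h ` cbox a b = cbox (?h a) (?h b)"
      proof
        show "?h ` cbox a b \<subseteq> cbox (?h a) (?h b)"
          by (auto simp: mem_box_cart)
        show "cbox (?h a) (?h b) \<subseteq> ?h ` cbox a b"
        proof
          fix x assume x: "x \<in> cbox (?h a) (?h b)"
          have "a $ i \<le> ?h x $ i \<and> ?h x $ i \<le> b $ i" for i
            using x[unfolded mem_box_cart, rule_format, of "Transposition.transpose m n i"] by simp
          then have "?h x \<in> cbox a b" by (simp add: mem_box_cart)
          moreover have "x = ?h (?h x)" by (simp add: vec_eq_iff)
          ultimately show "x \<in> ?h ` cbox a b" by blast
        qed
      qed
      moreover from this ne have ne': "cbox (?h a) (?h b) \<noteq> {}"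
        by (metis image_is_empty)
      moreover have "(\<Prod>i\<in>UNIV. b $ i - a $ i)
          = (\<Prod>i\<in>UNIV. b $ Transposition.transpose m n i - a $ Transposition.transpose m n i)"
        using prod.permute[OF permutes_swap_id[of m UNIV n], of "\<lambda>i. b $ i - a $ i"] by (simp add: o_def)
      ultimately show "measure lebesgue (?h ` cbox a b) = measure lebesgue (cbox a b)"
        using ne by (simp add: content_cbox_if_cart)
    qed
  next
    fix m n :: 'n
    assume mn: "m \<noteq> n"
    let ?h = "\<lambda>x::real^'n. \<chi> i. if i = m then x $ m + x $ n else x $ i"
    show "\<forall>S\<in>lmeasurable. ?h ` S \<in> lmeasurable \<and> measure lebesgue (?h ` S) = \<bar>det (matrix ?h)\<bar> * measure lebesgue S"
    proof (rule boxes)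
      show lin: "linear ?h"
        by (rule linearI) (auto simp: vec_eq_iff algebra_simps)
      have "matrix ?h = (\<chi> k. if k = m then row m (mat 1) + 1 *s row n (mat 1) else row k (mat 1 :: real^'n^'n))"
        by (auto simp: matrix_def vec_eq_iff row_def mat_def axis_def)
      then show "\<bar>det (matrix ?h)\<bar> = 1"
        by (simp only: det_row_operation[OF mn] det_I abs_one)
      fix a b :: "real^'n" assume ne: "cbox a b \<noteq> {}"
      have tr: "cbox a b = (+) a ` cbox 0 (b - a)"
        using cbox_translation[of a 0 "b - a"] by simp
      have "?h ` cbox a b = (+) (?h a) ` ?h ` cbox 0 (b - a)"
        unfolding tr image_image using linear_add[OF lin] by simp
      then have "measure lebesgue (?h ` cbox a b) = measure lebesgue (?h ` cbox 0 (b - a))"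
        by (simp only: measure_translation)
      also have "\<dots> = measure lebesgue (cbox 0 (b - a))"
        using mn ne tr by (intro measure_shear_interval) auto
      also have "\<dots> = measure lebesgue (cbox a b)"
        unfolding tr measure_translation by simp
      finally show "measure lebesgue (?h ` cbox a b) = measure lebesgue (cbox a b)" .
    qed
  qed
  with S show ?thesis by blast
qed

lemma emeasure_lebesgue_affine_image:
  fixes A :: "real^'n^'n" and b :: "real^'n"
  assumes S: "S \<in> sets lebesgue"
  shows "(\<lambda>y. A *v y + b) ` S \<in> sets lebesgue"
    and "emeasure lebesgue ((\<lambda>y. A *v y + b) ` S) = ennreal \<bar>det A\<bar> * emeasure lebesgue S"
proof -
  define T where "T n = S \<inter> cball 0 (real n)" for n :: nat
  define F where "F n = (\<lambda>y. A *v y + b) ` T n" for n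
  have T: "T n \<in> lmeasurable" for n
    unfolding T_def using S by (intro bounded_set_imp_lmeasurable) auto
  have F_eq: "F n = (+) b ` ((*v) A ` T n)" for n
    unfolding F_def by (auto simp: image_image add.commute)
  have F: "F n \<in> lmeasurable" for n
    unfolding F_eq using measure_linear_image_vec[OF matrix_vector_mul_linear T, of A n]
    by (intro measurable_translation) simp
  have "measure lebesgue (F n) = \<bar>det A\<bar> * measure lebesgue (T n)" for n
    unfolding F_eq measure_translation
    using measure_linear_image_vec[OF matrix_vector_mul_linear T, of A n] by simp
  then have eF: "emeasure lebesgue (F n) = ennreal \<bar>det A\<bar> * emeasure lebesgue (T n)" for n
    using F[of n] T[of n] by (simp add: emeasure_eq_measure2 ennreal_mult)
  have UT: "(\<Union>n. T n) = S"
  proof (intro set_eqI iffI)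
    fix x assume "x \<in> S"
    moreover obtain n :: nat where "norm x \<le> real n"
      using real_arch_simple by blast
    ultimately show "x \<in> (\<Union>n. T n)" by (auto simp: T_def)
  qed (auto simp: T_def)
  have UF: "(\<Union>n. F n) = (\<lambda>y. A *v y + b) ` S"
    unfolding F_def UT[symmetric] by blast
  have inc: "incseq T" "incseq F"
    unfolding F_def T_def by (auto intro!: incseq_SucI)
  show "(\<lambda>y. A *v y + b) ` S \<in> sets lebesgue"
    unfolding UF[symmetric] using F by (intro sets.countable_UN) (auto simp: fmeasurable_def)
  have rT: "range T \<subseteq> sets lebesgue" and rF: "range F \<subseteq> sets lebesgue"
    using T F by (auto simp: fmeasurable_def)
  have "emeasure lebesgue ((\<lambda>y. A *v y + b) ` S) = (SUP n. emeasure lebesgue (F n))"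
    using SUP_emeasure_incseq[OF rF inc(2)] UF by simp
  also have "\<dots> = ennreal \<bar>det A\<bar> * (SUP n. emeasure lebesgue (T n))"
    by (simp add: eF SUP_mult_left_ennreal)
  also have "\<dots> = ennreal \<bar>det A\<bar> * emeasure lebesgue S"
    using SUP_emeasure_incseq[OF rT inc(1)] UT by simp
  finally show "emeasure lebesgue ((\<lambda>y. A *v y + b) ` S) = ennreal \<bar>det A\<bar> * emeasure lebesgue S" .
qed

context pos_def_matrix
begin

text \<open>Completing the square turns the supporting inequality with slope \<open>A y + b\<close> into maximality of \<open>x\<close>.\<close>

lemma subdifferential_iff_maximizers:
  "A *v y + b \<in> subdifferential (\<lambda>x. v x + quadratic_function A b c x) x \<longleftrightarrow> x \<in> maximizers v y"
proof -
  have "v x' + quadratic_function A b c x' \<ge> v x + quadratic_function A b c x + (A *v y + b) \<bullet> (x' - x)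
     \<longleftrightarrow> - cost (x' - y) - v x' \<le> - cost (x - y) - v x" for x'
    by (simp add: cost_diff) (simp add: quadratic_function_def cost_def inner_diff_right inner_add_left inner_commute[of "A *v y"] algebra_simps)
  then show ?thesis
    by (simp add: subdifferential_def maximizers_def)
qed

lemma subdifferential_image_eq:
  "subdifferential_image (\<lambda>x. v x + quadratic_function A b c x) E
     = (\<lambda>y. A *v y + b) ` {y. maximizers v y \<inter> E \<noteq> {}}" (is "?L = ?R")
proof
  show "?R \<subseteq> ?L"
    using subdifferential_iff_maximizers unfolding subdifferential_image_def by blast
  show "?L \<subseteq> ?R"
  proof
    fix p assume "p \<in> ?L"
    then obtain x where x: "x \<in> E" "p \<in> subdifferential (\<lambda>x. v x + quadratic_function A b c x) x"
      unfolding subdifferential_image_def by blast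
    obtain y where y: "A *v y = p - b"
      using surj_A by (metis surjD)
    then have p: "p = A *v y + b" by simp
    then have "x \<in> maximizers v y"
      using x(2) subdifferential_iff_maximizers by blast
    with x(1) p show "p \<in> ?R" by blast
  qed
qed

text \<open>The set of points with a maximizer in \<open>E\<close> need not be Borel; it differs from the Borel preimage by a part of the null set of
  ambiguous points, and Lebesgue measure is complete.\<close>

lemma emeasure_maximizers_meet:
  assumes v: "admissible v" and E: "E \<in> sets borel"
  shows "{y. maximizers v y \<inter> E \<noteq> {}} \<in> sets lebesgue"
    and "emeasure lebesgue {y. maximizers v y \<inter> E \<noteq> {}} = emeasure lborel (optimal_map v -` E)"
proof -
  let ?W = "{y. maximizers v y \<inter> E \<noteq> {}}" and ?V = "optimal_map v -` E"
  have V: "?V \<in> sets borel"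
    using measurable_sets[OF optimal_map_borel[OF v] E] by simp
  have amb: "ambiguous v \<in> null_sets lebesgue"
    using ambiguous_null[OF v] by (simp add: null_sets_completionI)
  have N: "?W \<inter> ambiguous v \<in> null_sets lebesgue"
    by (rule null_sets_completion_subset[OF _ amb]) auto
  have eq: "?W = (?V - ambiguous v) \<union> (?W \<inter> ambiguous v)"
    using maximizers_eq_optimal_map[OF v] by (auto 4 3)
  have V': "?V - ambiguous v \<in> sets lebesgue"
    using V ambiguous_borel[OF v] by auto
  show "?W \<in> sets lebesgue"
    by (subst eq) (use V' N in auto)
  have "emeasure lebesgue ?W = emeasure lebesgue (?V - ambiguous v)"
    by (subst eq) (rule emeasure_Un_null_set[OF V' N])
  also have "\<dots> = emeasure lebesgue ?V"
    using V amb by (intro emeasure_Diff_null_set) auto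
  also have "\<dots> = emeasure lborel ?V"
    using V by simp
  finally show "emeasure lebesgue ?W = emeasure lborel ?V" .
qed

definition push_forward :: "(real^'n \<Rightarrow> real) \<Rightarrow> (real^'n) measure" where
  "push_forward v = distr (scale_measure (ennreal (det A)) lborel) borel (optimal_map v)"

lemma sets_push_forward [simp]: "sets (push_forward v) = sets borel"
  by (simp add: push_forward_def)

lemma emeasure_push_forward:
  assumes "admissible v" "E \<in> sets borel"
  shows "emeasure (push_forward v) E = ennreal (det A) * emeasure lborel (optimal_map v -` E)"
  unfolding push_forward_def
  using optimal_map_borel[OF assms(1)] assms(2) by (subst emeasure_distr) (auto simp: space_scale_measure)

lemma alexandrov_iff_push_forward:
  assumes v: "admissible v" and det: "0 < det A" and sets: "sets \<mu> = sets borel"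
    and conv: "convex_on UNIV (\<lambda>x. v x + quadratic_function A b c x)"
  shows "alexandrov_solution (\<lambda>x. v x + quadratic_function A b c x) \<mu> \<longleftrightarrow> push_forward v = \<mu>"
proof -
  have 1: "subdifferential_image (\<lambda>x. v x + quadratic_function A b c x) E \<in> sets lebesgue \<and>
      emeasure lebesgue (subdifferential_image (\<lambda>x. v x + quadratic_function A b c x) E)
       = emeasure (push_forward v) E" if "E \<in> sets borel" for E
    unfolding subdifferential_image_eq
    using emeasure_lebesgue_affine_image[OF emeasure_maximizers_meet(1)[OF v that], of A b]
      emeasure_maximizers_meet(2)[OF v that] emeasure_push_forward[OF v that] det by simp
  show ?thesis
  proof
    assume "alexandrov_solution (\<lambda>x. v x + quadratic_function A b c x) \<mu>"
    then have "emeasure (push_forward v) E = emeasure \<mu> E" if "E \<in> sets borel" for E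
      using 1[OF that] that unfolding alexandrov_solution_def by metis
    then show "push_forward v = \<mu>"
      using sets by (intro measure_eqI) auto
  next
    assume "push_forward v = \<mu>"
    with 1 conv show "alexandrov_solution (\<lambda>x. v x + quadratic_function A b c x) \<mu>"
      unfolding alexandrov_solution_def by metis
  qed
qed

text \<open>A change of variables turns the unit cell into its preimage under the transport map. This is another
  fundamental domain, so it may be exchanged for the unit cell again.\<close>

lemma nn_integral_push_forward_cell:
  assumes v: "admissible v" and f: "f \<in> borel_measurable borel"
    and per: "\<And>x z. z \<in> integer_lattice \<Longrightarrow> f (x + z) = (f x :: ennreal)"
  shows "(\<integral>\<^sup>+x. f x * indicator unit_cell x \<partial>push_forward v)
    = ennreal (det A) * (\<integral>\<^sup>+y. f (optimal_map v y) * indicator unit_cell y \<partial>lborel)"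
proof -
  note [measurable] = optimal_map_borel[OF v] f
  have m: "optimal_map v \<in> measurable (scale_measure (ennreal (det A)) lborel) borel"
    by simp
  have "(\<integral>\<^sup>+x. f x * indicator unit_cell x \<partial>push_forward v)
    = ennreal (det A) * (\<integral>\<^sup>+y. f (optimal_map v y) * indicator unit_cell (optimal_map v y) \<partial>lborel)"
    unfolding push_forward_def
    by (subst nn_integral_distr[OF m]) (auto simp: nn_integral_scale_measure)
  also have "(\<lambda>y. indicator unit_cell (optimal_map v y)) = (indicator (optimal_map v -` unit_cell) :: _ \<Rightarrow> ennreal)"
    by (auto simp: indicator_def)
  then have "(\<integral>\<^sup>+y. f (optimal_map v y) * indicator unit_cell (optimal_map v y) \<partial>lborel)
     = (\<integral>\<^sup>+y. f (optimal_map v y) * indicator (optimal_map v -` unit_cell) y \<partial>lborel)"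
    by (simp add: fun_eq_iff)
  also have "\<dots> = (\<integral>\<^sup>+y. f (optimal_map v y) * indicator unit_cell y \<partial>lborel)"
    by (intro nn_integral_fundamental_domain_cong lattice_periodic_lborel
        fundamental_domain_optimal_preimage v fundamental_domain_unit_cell)
       (auto simp: optimal_map_translate[OF v] per)
  finally show ?thesis .
qed

lemma lattice_periodic_push_forward:
  assumes v: "admissible v"
  shows "lattice_periodic_measure (push_forward v)"
  unfolding lattice_periodic_measure_def
proof (intro ballI)
  fix E :: "(real^'n) set" and z :: "real^'n" assume E: "E \<in> sets borel" and z: "z \<in> integer_lattice"
  have Ez: "(\<lambda>x. x + z) ` E \<in> sets borel"
    unfolding translate_eq_vimage using measurable_sets[of "\<lambda>x. x - z" borel borel E] E by simp
  have V: "optimal_map v -` E \<in> sets borel"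
    using measurable_sets[OF optimal_map_borel[OF v] E] by simp
  have "optimal_map v -` ((\<lambda>x. x + z) ` E) = (\<lambda>y. y + z) ` (optimal_map v -` E)"
    unfolding translate_eq_vimage using optimal_map_translate[OF v integer_lattice_uminus[OF z]] by auto
  then show "emeasure (push_forward v) ((\<lambda>x. x + z) ` E) = emeasure (push_forward v) E"
    using lattice_periodic_lborel[unfolded lattice_periodic_measure_def, rule_format, OF V z] E Ez
    by (simp add: emeasure_push_forward[OF v])
qed

end

section \<open>The dual functional and its minimizers\<close>

locale transport_problem = pos_def_matrix A for A :: "real^'n^'n" +
  fixes \<mu> :: "(real^'n) measure"
  assumes sets_mu: "sets \<mu> = sets borel"
    and periodic_mu: "lattice_periodic_measure \<mu>"
    and det_pos: "0 < det A"
    and mass: "emeasure \<mu> unit_cell = ennreal (det A)"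
begin

text \<open>Integration over the torus is represented by integration over one cell; as densities,
  both measures keep the whole space as their carrier, and periodic functions are integrated as they are.\<close>

definition source :: "(real^'n) measure" where
  "source = density lborel (indicator unit_cell)"

definition target :: "(real^'n) measure" where
  "target = density \<mu> (indicator unit_cell)"

lemma sets_source [simp, measurable_cong]: "sets source = sets borel"
  by (simp add: source_def)

lemma sets_target [simp, measurable_cong]: "sets target = sets borel"
  by (simp add: target_def sets_mu)

lemma emeasure_source: "E \<in> sets borel \<Longrightarrow> emeasure source E = emeasure lborel (E \<inter> unit_cell)"
  by (simp add: source_def emeasure_density indicator_inter_arith[symmetric] Int_commute)

lemma emeasure_target: "E \<in> sets borel \<Longrightarrow> emeasure target E = emeasure \<mu> (E \<inter> unit_cell)"
  using sets_mu
  by (simp add: target_def emeasure_density indicator_inter_arith[symmetric] Int_commute)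

lemma space_source [simp]: "space source = UNIV"
  using sets_eq_imp_space_eq[OF sets_source] by simp

lemma space_target [simp]: "space target = UNIV"
  using sets_eq_imp_space_eq[OF sets_target] by simp

sublocale source: finite_measure source
  by (rule finite_measureI) (simp add: emeasure_source emeasure_lborel_unit_cell)

sublocale target: finite_measure target
  by (rule finite_measureI) (simp add: emeasure_target mass)

lemma measure_source_UNIV [simp]: "measure source UNIV = 1"
  by (simp add: measure_def emeasure_source emeasure_lborel_unit_cell)

lemma measure_target_UNIV [simp]: "measure target UNIV = det A"
  using det_pos by (simp add: measure_def emeasure_target mass)

lemma admissible_borel: "admissible v \<Longrightarrow> v \<in> borel_measurable borel"
  unfolding admissible_def by (blast intro: borel_measurable_continuous_onI)

lemma admissible_bounded:
  assumes "admissible v" obtains K where "\<And>x. \<bar>v x\<bar> \<le> K"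
  using assms lattice_periodic_bounded unfolding admissible_def by blast

lemma integrable_source:
  assumes "f \<in> borel_measurable borel" "\<And>x. \<bar>f x\<bar> \<le> (K::real)"
  shows "integrable source f"
  using assms by (intro source.integrable_const_bound[of _ K]) auto

lemma integrable_target:
  assumes "f \<in> borel_measurable borel" "\<And>x. \<bar>f x\<bar> \<le> (K::real)"
  shows "integrable target f"
  using assms by (intro target.integrable_const_bound[of _ K]) auto

lemma integrable_source_admissible: "admissible v \<Longrightarrow> integrable source v"
  by (metis admissible_bounded admissible_borel integrable_source)

lemma integrable_target_admissible: "admissible v \<Longrightarrow> integrable target v"
  by (metis admissible_bounded admissible_borel integrable_target)

text \<open>The Kantorovich dual functional of the transport of \<open>det A\<close> times Lebesgue measure to \<open>\<mu>\<close> on the torus.\<close>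

definition dual_functional :: "(real^'n \<Rightarrow> real) \<Rightarrow> real" where
  "dual_functional v = (\<integral>x. v x \<partial>target) + det A * (\<integral>y. transform v y \<partial>source)"

lemma admissible_add_const: "admissible v \<Longrightarrow> admissible (\<lambda>x. v x + k)"
  unfolding admissible_def lattice_periodic_def by (auto intro!: continuous_intros)

lemma admissible_add_scaled: "admissible v \<Longrightarrow> admissible w \<Longrightarrow> admissible (\<lambda>x. v x + t * w x)"
  unfolding admissible_def lattice_periodic_def by (auto intro!: continuous_intros)

lemma transform_le_add:
  assumes v: "admissible v" and w: "admissible w" and le: "\<And>x. w x \<le> v x + e"
  shows "transform v y \<le> transform w y + e"
proof (rule transform_le[OF v])
  fix x
  show "- cost (x - y) - v x \<le> transform w y + e"
    using transform_ge[OF w, of x y] le[of x] by linarith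
qed

lemma dual_functional_le_add:
  assumes v: "admissible v" and w: "admissible w" and close: "\<And>x. \<bar>v x - w x\<bar> \<le> e"
  shows "dual_functional v \<le> dual_functional w + 2 * det A * e"
proof -
  have "(\<integral>x. v x \<partial>target) \<le> (\<integral>x. w x + e \<partial>target)"
    using integrable_target_admissible v w close
    by (intro integral_mono) (auto intro: order_trans simp: abs_le_iff algebra_simps)
  moreover have "(\<integral>x. w x + e \<partial>target) = (\<integral>x. w x \<partial>target) + det A * e"
    using integrable_target_admissible[OF w] by simp
  moreover have "(\<integral>y. transform v y \<partial>source) \<le> (\<integral>y. transform w y + e \<partial>source)"
  proof (intro integral_mono)
    show "transform v y \<le> transform w y + e" for y
      using close by (intro transform_le_add v w) (simp add: abs_le_iff algebra_simps)
  qed (use integrable_source_admissible admissible_transform v w in auto)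
  moreover have "(\<integral>y. transform w y + e \<partial>source) = (\<integral>y. transform w y \<partial>source) + e"
    using integrable_source_admissible[OF admissible_transform[OF w]] by simp
  ultimately have "(\<integral>x. v x \<partial>target) \<le> (\<integral>x. w x \<partial>target) + det A * e"
    "(\<integral>y. transform v y \<partial>source) \<le> (\<integral>y. transform w y \<partial>source) + e" by linarith+
  from this(1) mult_left_mono[OF this(2), of "det A"] show ?thesis
    unfolding dual_functional_def using det_pos by (simp add: algebra_simps)
qed

lemma transform_add_const:
  assumes "admissible v"
  shows "transform (\<lambda>x. v x + k) = (\<lambda>y. transform v y - k)"
proof (rule ext)
  fix y
  have "transform (\<lambda>x. v x + k) y \<le> transform v y + - k"
    by (intro transform_le_add admissible_add_const assms) simp
  moreover have "transform v y \<le> transform (\<lambda>x. v x + k) y + k"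
    by (intro transform_le_add admissible_add_const assms) simp
  ultimately show "transform (\<lambda>x. v x + k) y = transform v y - k" by simp
qed

text \<open>The transform turns \<open>+ k\<close> into \<open>- k\<close>, and both sides of the transport problem have mass \<open>det A\<close> per
  period, so the two contributions of \<open>k\<close> cancel.\<close>

lemma dual_functional_add_const:
  assumes v: "admissible v"
  shows "dual_functional (\<lambda>x. v x + k) = dual_functional v"
  unfolding dual_functional_def transform_add_const[OF v]
  using integrable_target_admissible[OF v] integrable_source_admissible[OF admissible_transform[OF v]]
  by (simp add: algebra_simps)

lemma dual_functional_transform_transform:
  assumes v: "admissible v"
  shows "dual_functional (transform (transform v)) \<le> dual_functional v"
proof -
  have "(\<integral>x. transform (transform v) x \<partial>target) \<le> (\<integral>x. v x \<partial>target)"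
    by (intro integral_mono integrable_target_admissible admissible_transform transform_transform_le v)
  then show ?thesis
    unfolding dual_functional_def transform_transform_transform[OF v] by simp
qed

lemma add_transform_ge:
  assumes v: "admissible v"
  shows "- cell_bound \<le> v x + transform v y"
proof -
  obtain z where "z \<in> integer_lattice" "cost (x + z - y) \<le> cell_bound"
    by (rule lattice_translate_near)
  then show ?thesis
    using transform_ge[OF v, of "x + z" y] admissible_periodic[OF v, of z x] by linarith
qed

lemma transform_oscillation:
  assumes v: "admissible v"
  shows "\<bar>transform v y - transform v y'\<bar> \<le> cell_bound"
proof -
  have "transform v a \<le> transform v b + cell_bound" for a b
  proof -
    obtain x where "x \<in> maximizers v a"
      using maximizers_nonempty[OF v] by blast
    from transform_eq[OF this] add_transform_ge[OF v, of x b] cost_nonneg[of "x - a"]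
    show ?thesis by linarith
  qed
  from this[of y y'] this[of y' y] show ?thesis by (simp add: abs_le_iff)
qed

lemma dual_functional_bounded_below:
  assumes v: "admissible v"
  shows "- cell_bound * det A \<le> dual_functional v"
proof -
  let ?I = "\<integral>x. v x \<partial>target"
  have "- cell_bound - ?I / det A \<le> transform v y" for y
  proof -
    have "(\<integral>x. - cell_bound - transform v y \<partial>target) \<le> ?I"
      using add_transform_ge[OF v, of _ y] integrable_target_admissible[OF v]
      by (intro integral_mono) (auto simp: algebra_simps)
    then have "det A * (- cell_bound - transform v y) \<le> ?I"
      by simp
    then show ?thesis using det_pos by (simp add: field_simps)
  qed
  then have "(\<integral>y. - cell_bound - ?I / det A \<partial>source) \<le> (\<integral>y. transform v y \<partial>source)"
    using integrable_source_admissible[OF admissible_transform[OF v]] by (intro integral_mono) auto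
  then have "- cell_bound - ?I / det A \<le> (\<integral>y. transform v y \<partial>source)"
    by simp
  from mult_left_mono[OF this, of "det A"]
  have "det A * (- cell_bound - ?I / det A) \<le> det A * (\<integral>y. transform v y \<partial>source)"
    using det_pos by simp
  moreover have "det A * (- cell_bound - ?I / det A) = - cell_bound * det A - ?I"
    using det_pos by (simp add: right_diff_distrib)
  ultimately show ?thesis
    unfolding dual_functional_def by linarith
qed

text \<open>Replace a minimizing sequence by its double transforms, shifted to vanish at \<open>0\<close>. This does not
  increase the functional, and the new sequence is uniformly bounded and equicontinuous. A limit on the
  closed cell extends periodically, and the functional is continuous for uniform convergence.\<close>

lemma dual_functional_attains_minimum:
  obtains v where "admissible v" "\<And>w. admissible w \<Longrightarrow> dual_functional v \<le> dual_functional w"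
proof -
  define I where "I = Inf (dual_functional ` {v. admissible v})"
  have adm0: "admissible (\<lambda>x. 0)"
    by (simp add: admissible_def lattice_periodic_def)
  have bdd: "bdd_below (dual_functional ` {v. admissible v})"
    using dual_functional_bounded_below by (intro bdd_belowI[of _ "- cell_bound * det A"]) auto
  have I_le: "I \<le> dual_functional w" if "admissible w" for w
    unfolding I_def using that by (intro cInf_lower bdd) auto
  have "\<exists>w. admissible w \<and> dual_functional w < I + inverse (real (Suc k))" for k
    using cInf_lessD[of "dual_functional ` {v. admissible v}" "I + inverse (real (Suc k))"] adm0
    unfolding I_def by auto
  then obtain w where w: "\<And>k. admissible (w k)" "\<And>k. dual_functional (w k) < I + inverse (real (Suc k))"
    by metis
  define m where "m k = - transform (transform (w k)) 0" for k
  define f where "f k = (\<lambda>x. transform (transform (w k)) x + m k)" for k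
  have f: "admissible (f k)" for k
    unfolding f_def by (intro admissible_add_const admissible_transform w)
  have Jf: "dual_functional (f k) < I + inverse (real (Suc k))" for k
    unfolding f_def
    using dual_functional_add_const[OF admissible_transform[OF admissible_transform[OF w(1)]]]
      dual_functional_transform_transform[OF w(1), of k] w(2)[of k] by (metis order_le_less_trans)
  have f_bound: "norm (f k x) \<le> cell_bound" for k x
    unfolding f_def using transform_oscillation[OF admissible_transform[OF w(1)], of k x 0] by (simp add: m_def)
  have f_lip: "\<bar>f k y - f k x\<bar> \<le> lipschitz_bound * norm (y - x)" if "norm (y - x) \<le> 1" for k x y
    unfolding f_def using transform_lipschitz[OF admissible_transform[OF w(1)] that, of k] by simp
  \<comment> \<open>The summand 1 keeps the denominator positive when the Lipschitz bound is zero.\<close>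
  have equi: "\<exists>d. 0 < d \<and> (\<forall>k y. y \<in> cbox 0 1 \<and> norm (x - y) < d \<longrightarrow> norm (f k x - f k y) < e)"
    if e: "0 < e" for x e
  proof (intro exI conjI allI impI)
    show "0 < min 1 (e / (lipschitz_bound + 1))"
      using e lipschitz_bound_nonneg by simp
    fix k y assume "y \<in> cbox 0 1 \<and> norm (x - y) < min 1 (e / (lipschitz_bound + 1))"
    then have near: "norm (x - y) \<le> 1" "norm (x - y) < e / (lipschitz_bound + 1)" by auto
    have "norm (f k x - f k y) \<le> lipschitz_bound * norm (x - y)"
      using f_lip[OF near(1)] by simp
    also have "\<dots> \<le> (lipschitz_bound + 1) * norm (x - y)"
      by (intro mult_right_mono) auto
    also have "\<dots> < e"
      using near(2) lipschitz_bound_nonneg by (simp add: field_simps)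
    finally show "norm (f k x - f k y) < e" .
  qed
  obtain g r where g: "strict_mono (r :: nat \<Rightarrow> nat)"
      "\<And>e. 0 < e \<Longrightarrow> \<exists>N. \<forall>n x. N \<le> n \<and> x \<in> cbox 0 1 \<longrightarrow> norm (f (r n) x - g x) < e"
    by (rule Arzela_Ascoli[of "cbox 0 1" f cell_bound]) (use f_bound equi in auto)
  \<comment> \<open>The limit is known on the closed cell only; translating into the half-open cell extends it.\<close>
  define s where "s x = (SOME z. z \<in> integer_lattice \<and> x + z \<in> unit_cell)" for x :: "real^'n"
  have s: "s x \<in> integer_lattice \<and> x + s x \<in> unit_cell" for x
    unfolding s_def by (rule someI_ex) (metis lattice_translate_into_unit_cell)
  define v where "v x = g (x + s x)" for x
  have conv: "\<exists>N. \<forall>n\<ge>N. \<forall>x. \<bar>f (r n) x - v x\<bar> < e" if "0 < e" for e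
  proof -
    obtain N where N: "\<And>n x. N \<le> n \<Longrightarrow> x \<in> cbox 0 1 \<Longrightarrow> norm (f (r n) x - g x) < e"
      using g(2)[OF \<open>0 < e\<close>] by blast
    have "\<bar>f (r n) x - v x\<bar> < e" if "N \<le> n" for n x
    proof -
      have "x + s x \<in> cbox 0 1"
        using s unit_cell_subset_cbox by blast
      from N[OF that this] show ?thesis
        using admissible_periodic[OF f, of "s x" "r n" x] s by (simp add: v_def)
    qed
    then show ?thesis by blast
  qed
  have ul: "uniform_limit UNIV (\<lambda>n. f (r n)) v sequentially"
    unfolding uniform_limit_sequentially_iff using conv by (auto simp: dist_real_def)
  have v: "admissible v"
    unfolding admissible_def
  proof
    show "continuous_on UNIV v"
      by (rule uniform_limit_theorem[OF _ ul]) (use f in \<open>auto simp: admissible_def\<close>)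
    have lim: "(\<lambda>n. f (r n) x) \<longlonglongrightarrow> v x" for x
      using tendsto_uniform_limitI[OF ul] by simp
    show "lattice_periodic v"
      unfolding lattice_periodic_def
    proof (intro allI ballI)
      fix x and z :: "real^'n" assume "z \<in> integer_lattice"
      then have "(\<lambda>n. f (r n) (x + z)) = (\<lambda>n. f (r n) x)"
        using admissible_periodic[OF f] by blast
      then show "v (x + z) = v x"
        using lim[of x] lim[of "x + z"] LIMSEQ_unique by metis
    qed
  qed
  have "dual_functional v \<le> I"
  proof (rule field_le_epsilon)
    fix e :: real assume e: "0 < e"
    then have e': "0 < e / (4 * det A)" using det_pos by simp
    obtain N where N: "\<And>n x. N \<le> n \<Longrightarrow> \<bar>f (r n) x - v x\<bar> < e / (4 * det A)"
      using conv[OF e'] by blast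
    obtain M where M: "inverse (real (Suc M)) < e / 2"
      using reals_Archimedean[of "e / 2"] e by auto
    define n where "n = max N M"
    have "dual_functional v \<le> dual_functional (f (r n)) + 2 * det A * (e / (4 * det A))"
      using N[of n] by (intro dual_functional_le_add v f) (simp add: n_def abs_minus_commute less_imp_le)
    also have "2 * det A * (e / (4 * det A)) = e / 2"
      using det_pos by simp
    also have "dual_functional (f (r n)) \<le> I + inverse (real (Suc (r n)))"
      using Jf[of "r n"] by simp
    also have "inverse (real (Suc (r n))) \<le> inverse (real (Suc M))"
      using seq_suble[OF g(1), of n] by (intro le_imp_inverse_le) (auto simp: n_def)
    also have "inverse (real (Suc M)) \<le> e / 2" using M by simp
    finally show "dual_functional v \<le> I + e" by simp
  qed
  then show ?thesis
    using I_le v that order_trans by blast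
qed

section \<open>The Euler-Lagrange equation\<close>

text \<open>Maximizers of the perturbed problems stay bounded, each of their limit points maximizes the unperturbed
  problem, and at an unambiguous point there is only one such maximizer.\<close>

lemma perturbed_maximizers_tendsto:
  assumes v: "admissible v" and \<phi>: "admissible \<phi>" and y: "y \<notin> ambiguous v"
    and t: "t \<longlonglongrightarrow> 0" and x: "\<And>k. x k \<in> maximizers (\<lambda>x. v x + t k * \<phi> x) y"
  shows "x \<longlonglongrightarrow> optimal_map v y"
proof (rule ccontr)
  assume "\<not> x \<longlonglongrightarrow> optimal_map v y"
  then obtain e where e: "0 < e" "\<not> (\<forall>\<^sub>F k in sequentially. dist (x k) (optimal_map v y) < e)"
    unfolding tendsto_iff by blast
  then have "\<exists>\<^sub>F k in sequentially. \<not> dist (x k) (optimal_map v y) < e"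
    by (simp add: frequently_def)
  then have "infinite {k. \<not> dist (x k) (optimal_map v y) < e}"
    unfolding cofinite_eq_sequentially[symmetric] frequently_cofinite .
  then obtain r where r: "strict_mono (r :: nat \<Rightarrow> nat)" "\<And>k. \<not> dist (x (r k)) (optimal_map v y) < e"
    using infinite_enumerate by blast
  have "norm (x k) \<le> norm y + radius" for k
    using maximizers_near(2)[OF admissible_add_scaled[OF v \<phi>] x[of k]] norm_triangle_ineq[of "x k - y" y] by simp
  then have "bounded (range (x \<circ> r))"
    unfolding bounded_iff by auto
  then obtain a r' where r': "strict_mono r'" "((x \<circ> r) \<circ> r') \<longlonglongrightarrow> a"
    using bounded_imp_convergent_subsequence by blast
  define p where "p k = x (r (r' k))" for k
  define \<tau> where "\<tau> k = t (r (r' k))" for k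
  have "p = (x \<circ> r) \<circ> r'"
    by (auto simp: p_def fun_eq_iff)
  with r'(2) have p: "p \<longlonglongrightarrow> a" by simp
  have \<tau>: "\<tau> \<longlonglongrightarrow> 0"
    using LIMSEQ_subseq_LIMSEQ[OF LIMSEQ_subseq_LIMSEQ[OF t r(1)] r'(1)] by (simp add: \<tau>_def[abs_def] o_def)
  have cont: "isCont cost w" "isCont v w" "isCont \<phi> w" for w
    using continuous_on_cost[OF continuous_on_id, of UNIV] v \<phi>
    by (auto simp: admissible_def continuous_on_eq_continuous_at)
  have "a \<in> maximizers v y"
    unfolding maximizers_def
  proof (intro CollectI allI)
    fix x'
    have "(\<lambda>k. - cost (x' - y) - (v x' + \<tau> k * \<phi> x')) \<longlonglongrightarrow> - cost (x' - y) - (v x' + 0 * \<phi> x')"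
      by (intro tendsto_intros \<tau>)
    moreover have "(\<lambda>k. - cost (p k - y) - (v (p k) + \<tau> k * \<phi> (p k))) \<longlonglongrightarrow> - cost (a - y) - (v a + 0 * \<phi> a)"
      by (intro tendsto_intros \<tau> isCont_tendsto_compose[OF cont(1)] isCont_tendsto_compose[OF cont(2)]
          isCont_tendsto_compose[OF cont(3)] p)
    moreover have "- cost (x' - y) - (v x' + \<tau> k * \<phi> x') \<le> - cost (p k - y) - (v (p k) + \<tau> k * \<phi> (p k))" for k
      using x[of "r (r' k)"] unfolding maximizers_def p_def \<tau>_def by blast
    ultimately have "- cost (x' - y) - (v x' + 0 * \<phi> x') \<le> - cost (a - y) - (v a + 0 * \<phi> a)"
      by (intro LIMSEQ_le) auto
    then show "- cost (x' - y) - v x' \<le> - cost (a - y) - v a" by simp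
  qed
  then have "a = optimal_map v y"
    using maximizers_eq_optimal_map[OF v y] by simp
  with p have "(\<lambda>k. dist (p k) (optimal_map v y)) \<longlonglongrightarrow> 0"
    using tendsto_dist_iff by blast
  then have "e \<le> 0"
    by (rule LIMSEQ_le_const) (use r(2) in \<open>auto simp: p_def not_less\<close>)
  with e(1) show False by simp
qed

lemma AE_source_not_ambiguous:
  assumes v: "admissible v"
  shows "AE y in source. y \<notin> ambiguous v"
proof -
  have "AE y in lborel. y \<notin> ambiguous v"
    by (rule AE_not_in[OF ambiguous_null[OF v]])
  then show ?thesis
    unfolding source_def by (subst AE_density) auto
qed

text \<open>Compare \<open>v\<close> with \<open>v + t \<phi>\<close> for \<open>t \<down> 0\<close>. The quotient \<open>D\<close> lies between the values of \<open>\<phi>\<close> at a perturbed and at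
  an unperturbed maximizer, so it is bounded and tends to \<open>\<phi> (optimal_map v y)\<close> almost everywhere.\<close>

lemma euler_lagrange_le:
  assumes v: "admissible v" and min: "\<And>w. admissible w \<Longrightarrow> dual_functional v \<le> dual_functional w"
    and \<phi>: "admissible \<phi>"
  shows "det A * (\<integral>y. \<phi> (optimal_map v y) \<partial>source) \<le> (\<integral>x. \<phi> x \<partial>target)"
proof -
  define t where "t k = inverse (real (Suc k))" for k
  have t: "t \<longlonglongrightarrow> 0" "0 < t k" for k
    unfolding t_def by (rule LIMSEQ_inverse_real_of_nat) simp
  define w where "w k x = v x + t k * \<phi> x" for k x
  have w: "admissible (w k)" for k
    unfolding w_def by (intro admissible_add_scaled v \<phi>)
  define D where "D k y = (transform v y - transform (w k) y) / t k" for k y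
  obtain K where K: "\<And>x. \<bar>\<phi> x\<bar> \<le> K"
    using admissible_bounded[OF \<phi>] by blast
  have lower: "\<phi> x \<le> D k y" if "x \<in> maximizers (w k) y" for x k y
  proof -
    have "t k * \<phi> x \<le> transform v y - transform (w k) y"
      using transform_eq[OF that] transform_ge[OF v, of x y] by (simp add: w_def)
    then show ?thesis
      using t(2)[of k] by (simp add: D_def field_simps)
  qed
  have upper: "D k y \<le> \<phi> x" if "x \<in> maximizers v y" for x k y
  proof -
    have "transform v y - transform (w k) y \<le> t k * \<phi> x"
      using transform_eq[OF that] transform_ge[OF w, of x y k] by (simp add: w_def)
    then show ?thesis
      using t(2)[of k] by (simp add: D_def field_simps)
  qed
  have D_bound: "\<bar>D k y\<bar> \<le> K" for k y
  proof -
    obtain x x' where "x \<in> maximizers (w k) y" "x' \<in> maximizers v y"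
      using maximizers_nonempty[OF v] maximizers_nonempty[OF w] by blast
    then show ?thesis
      using lower[of x k y] upper[of x' y k] K[of x] K[of x'] by (simp add: abs_le_iff)
  qed
  have D_meas: "D k \<in> borel_measurable borel" for k
    unfolding D_def using admissible_borel[OF admissible_transform] v w by measurable
  have \<phi>_cont: "isCont \<phi> x" for x
    using \<phi> by (simp add: admissible_def continuous_on_eq_continuous_at)
  have D_lim: "(\<lambda>k. D k y) \<longlonglongrightarrow> \<phi> (optimal_map v y)" if y: "y \<notin> ambiguous v" for y
  proof -
    have "\<forall>k. \<exists>x. x \<in> maximizers (w k) y"
      using maximizers_nonempty[OF w] by blast
    then obtain x where x: "\<And>k. x k \<in> maximizers (w k) y"
      by metis
    have "x \<longlonglongrightarrow> optimal_map v y"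
      by (rule perturbed_maximizers_tendsto[OF v \<phi> y t(1)]) (use x in \<open>simp add: w_def[abs_def]\<close>)
    then have "(\<lambda>k. \<phi> (x k)) \<longlonglongrightarrow> \<phi> (optimal_map v y)"
      by (rule isCont_tendsto_compose[OF \<phi>_cont])
    then show ?thesis
    proof (rule tendsto_sandwich[rotated 2, OF _ tendsto_const])
      show "\<forall>\<^sub>F k in sequentially. \<phi> (x k) \<le> D k y"
        using lower[OF x] by simp
      show "\<forall>\<^sub>F k in sequentially. D k y \<le> \<phi> (optimal_map v y)"
        using upper[of "optimal_map v y" y] maximizers_eq_optimal_map[OF v y] by simp
    qed
  qed
  have comp_meas: "(\<lambda>y. \<phi> (optimal_map v y)) \<in> borel_measurable borel"
    using measurable_compose[OF optimal_map_borel[OF v] admissible_borel[OF \<phi>]] .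
  have "(\<lambda>k. \<integral>y. D k y \<partial>source) \<longlonglongrightarrow> (\<integral>y. \<phi> (optimal_map v y) \<partial>source)"
  proof (rule integral_dominated_convergence[where w = "\<lambda>_. K"])
    show "AE y in source. (\<lambda>k. D k y) \<longlonglongrightarrow> \<phi> (optimal_map v y)"
      using AE_source_not_ambiguous[OF v] by eventually_elim (rule D_lim)
  qed (use D_meas comp_meas D_bound in auto)
  then have lim: "(\<lambda>k. det A * (\<integral>y. D k y \<partial>source)) \<longlonglongrightarrow> det A * (\<integral>y. \<phi> (optimal_map v y) \<partial>source)"
    by (intro tendsto_intros)
  have "det A * (\<integral>y. D k y \<partial>source) \<le> (\<integral>x. \<phi> x \<partial>target)" for k
  proof -
    have 1: "(\<integral>x. w k x \<partial>target) = (\<integral>x. v x \<partial>target) + t k * (\<integral>x. \<phi> x \<partial>target)"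
      unfolding w_def using integrable_target_admissible v \<phi> by simp
    have 2: "(\<integral>y. D k y \<partial>source) = ((\<integral>y. transform v y \<partial>source) - (\<integral>y. transform (w k) y \<partial>source)) / t k"
      unfolding D_def using integrable_source_admissible[OF admissible_transform] v w by simp
    have "t k * (det A * (\<integral>y. D k y \<partial>source))
        = det A * ((\<integral>y. transform v y \<partial>source) - (\<integral>y. transform (w k) y \<partial>source))"
      using t(2)[of k] by (simp add: 2)
    also have "\<dots> \<le> t k * (\<integral>x. \<phi> x \<partial>target)"
      using min[OF w, of k] unfolding dual_functional_def 1 by (simp add: algebra_simps)
    finally show ?thesis
      using t(2)[of k] by simp
  qed
  with lim show ?thesis
    by (intro LIMSEQ_le_const2[OF lim]) auto
qed

lemma euler_lagrange:
  assumes v: "admissible v" and min: "\<And>w. admissible w \<Longrightarrow> dual_functional v \<le> dual_functional w"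
    and \<phi>: "admissible \<phi>"
  shows "(\<integral>x. \<phi> x \<partial>target) = det A * (\<integral>y. \<phi> (optimal_map v y) \<partial>source)"
proof -
  have "admissible (\<lambda>x. - \<phi> x)"
    using \<phi> unfolding admissible_def lattice_periodic_def by (auto intro!: continuous_intros)
  from euler_lagrange_le[OF v min this] euler_lagrange_le[OF v min \<phi>] show ?thesis by simp
qed

text \<open>Indicators of closed periodic sets are limits of continuous periodic functions of the distance, so
  the Euler-Lagrange equation gives equality on such sets, and these determine a periodic measure.\<close>

theorem minimizer_pushes_forward:
  assumes v: "admissible v" and min: "\<And>w. admissible w \<Longrightarrow> dual_functional v \<le> dual_functional w"
  shows "push_forward v = \<mu>"
proof -
  have "\<mu> = push_forward v"
  proof (rule periodic_measure_eqI[OF sets_mu sets_push_forward periodic_mu lattice_periodic_push_forward[OF v]])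
    show "emeasure \<mu> unit_cell < \<infinity>"
      by (simp add: mass)
    fix C :: "(real^'n) set"
    assume C: "closed C" and per: "\<And>x z. z \<in> integer_lattice \<Longrightarrow> x + z \<in> C \<longleftrightarrow> x \<in> C"
    have Cb: "C \<in> sets borel" and TC: "optimal_map v -` C \<in> sets borel"
      using C measurable_sets[OF optimal_map_borel[OF v], of C] by auto
    have "measure target C = det A * measure source (optimal_map v -` C)"
    proof (cases "C = {}")
      case False
      define \<phi> where "\<phi> k x = max 0 (1 - real k * infdist x C)" for k x
      have inf_per: "infdist (x + z) C = infdist x C" if z: "z \<in> integer_lattice" for x z
      proof -
        have "infdist (x + z) C \<le> infdist x C" if z: "z \<in> integer_lattice" for x z
        proof -
          obtain c where c: "c \<in> C" "infdist x C = dist x c"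
            using infdist_attains_inf[OF C False] by blast
          have "infdist (x + z) C \<le> dist (x + z) (c + z)"
            using c(1) per[OF z] by (intro infdist_le) auto
          then show ?thesis using c(2) by simp
        qed
        from this[OF z, of x] this[OF integer_lattice_uminus[OF z], of "x + z"] show ?thesis by simp
      qed
      have \<phi>: "admissible (\<phi> k)" for k
        unfolding admissible_def lattice_periodic_def \<phi>_def
        by (auto simp: inf_per intro!: continuous_intros)
      have \<phi>_bound: "norm (\<phi> k x) \<le> 1" for k x
        using infdist_nonneg[of x C] by (simp add: \<phi>_def)
      have \<phi>_lim: "(\<lambda>k. \<phi> k x) \<longlonglongrightarrow> indicator C x" for x
      proof (cases "x \<in> C")
        case True
        then show ?thesis by (simp add: \<phi>_def)
      next
        case out: False
        then have pos: "0 < infdist x C"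
          using C False by (metis in_closed_iff_infdist_zero infdist_nonneg less_eq_real_def)
        obtain N :: nat where N: "1 < real N * infdist x C"
          using reals_Archimedean3[OF pos] by blast
        have "\<phi> k x = 0" if "N \<le> k" for k
        proof -
          have "real N * infdist x C \<le> real k * infdist x C"
            using that pos by (intro mult_right_mono) auto
          then show ?thesis using N by (simp add: \<phi>_def)
        qed
        then have "\<forall>\<^sub>F k in sequentially. \<phi> k x = 0"
          using eventually_sequentially by blast
        then show ?thesis
          using out by (simp add: tendsto_eventually)
      qed
      have "(\<lambda>k. \<integral>x. \<phi> k x \<partial>target) \<longlonglongrightarrow> (\<integral>x. indicator C x \<partial>target)"
        by (rule integral_dominated_convergence[where w = "\<lambda>_. 1"])
          (use Cb \<phi>_lim \<phi>_bound admissible_borel[OF \<phi>] in auto)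
      moreover have comp: "(\<lambda>y. f (optimal_map v y)) \<in> borel_measurable borel"
        if "f \<in> borel_measurable borel" for f :: "real^'n \<Rightarrow> real"
        using measurable_compose[OF optimal_map_borel[OF v] that] .
      have "(\<lambda>k. \<integral>y. \<phi> k (optimal_map v y) \<partial>source) \<longlonglongrightarrow> (\<integral>y. indicator C (optimal_map v y) \<partial>source)"
        by (rule integral_dominated_convergence[where w = "\<lambda>_. 1"])
          (use \<phi>_lim \<phi>_bound comp[OF admissible_borel[OF \<phi>]] comp[OF borel_measurable_indicator[OF Cb]] in auto)
      then have "(\<lambda>k. det A * (\<integral>y. \<phi> k (optimal_map v y) \<partial>source)) \<longlonglongrightarrow> det A * (\<integral>y. indicator C (optimal_map v y) \<partial>source)"
        by (intro tendsto_intros)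
      then have "(\<lambda>k. \<integral>x. \<phi> k x \<partial>target) \<longlonglongrightarrow> det A * (\<integral>y. indicator C (optimal_map v y) \<partial>source)"
        by (simp only: euler_lagrange[OF v min \<phi>])
      ultimately have "(\<integral>x. indicator C x \<partial>target) = det A * (\<integral>y. indicator C (optimal_map v y) \<partial>source)"
        by (rule LIMSEQ_unique)
      moreover have "(\<lambda>y. indicator C (optimal_map v y)) = (indicator (optimal_map v -` C) :: _ \<Rightarrow> real)"
        by (auto simp: indicator_def)
      ultimately show ?thesis
        using Cb TC by simp
    qed simp
    then have "emeasure target C = ennreal (det A) * emeasure source (optimal_map v -` C)"
      using det_pos by (simp add: target.emeasure_eq_measure source.emeasure_eq_measure ennreal_mult)
    moreover have "emeasure (push_forward v) (C \<inter> unit_cell)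
        = ennreal (det A) * emeasure lborel (optimal_map v -` C \<inter> unit_cell)"
    proof -
      have Cm: "(indicator C :: _ \<Rightarrow> ennreal) \<in> borel_measurable borel"
        using Cb by simp
      have ind: "indicator C (optimal_map v y) = (indicator (optimal_map v -` C) y :: ennreal)" for y
        by (auto simp: indicator_def)
      have iper: "indicator C (x + z) = (indicator C x :: ennreal)" if "z \<in> integer_lattice" for x z
        by (simp add: indicator_def per[OF that])
      have "(\<integral>\<^sup>+x. indicator C x * indicator unit_cell x \<partial>push_forward v)
          = ennreal (det A) * (\<integral>\<^sup>+y. indicator (optimal_map v -` C) y * indicator unit_cell y \<partial>lborel)"
        using nn_integral_push_forward_cell[OF v Cm iper] by (simp only: ind)
      then show ?thesis
        using Cb TC by (simp add: indicator_inter_arith[symmetric])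
    qed
    ultimately show "emeasure \<mu> (C \<inter> unit_cell) = emeasure (push_forward v) (C \<inter> unit_cell)"
      using Cb TC by (simp add: emeasure_target emeasure_source)
  qed
  then show ?thesis by simp
qed

end

section \<open>Convexity and subgradients\<close>

text \<open>Separate the strict epigraph from the point \<open>(x, u x)\<close>. The separating hyperplane is not vertical, as
  \<open>u\<close> is finite everywhere; its slope is the subgradient.\<close>

lemma convex_has_subgradient:
  fixes u :: "'a::euclidean_space \<Rightarrow> real"
  assumes u: "convex_on UNIV u"
  obtains p where "p \<in> subdifferential u x"
proof -
  let ?S = "{z :: 'a \<times> real. u (fst z) < snd z}"
  have "convex ?S"
  proof (rule convexI, clarsimp)
    fix a s b t and \<alpha> \<beta> :: real
    assume st: "u a < s" "u b < t" and c: "0 \<le> \<alpha>" "0 \<le> \<beta>" "\<alpha> + \<beta> = 1"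
    have "u (\<alpha> *\<^sub>R a + \<beta> *\<^sub>R b) \<le> \<alpha> * u a + \<beta> * u b"
      using u c unfolding convex_on_def by auto
    also have "\<dots> < \<alpha> * s + \<beta> * t"
    proof (cases "\<alpha> = 0")
      case False
      then show ?thesis
        using st c by (intro add_less_le_mono mult_strict_left_mono mult_left_mono) auto
    qed (use st c in auto)
    finally show "u (\<alpha> *\<^sub>R a + \<beta> *\<^sub>R b) < \<alpha> * s + \<beta> * t" .
  qed
  moreover have "(x, u x + 1) \<in> ?S" by simp
  then have "?S \<noteq> {}" by blast
  moreover have "?S \<inter> {(x, u x)} = {}" by auto
  ultimately obtain a b where ab: "a \<noteq> 0" "\<forall>z\<in>?S. a \<bullet> z \<le> b" "\<forall>z\<in>{(x, u x)}. b \<le> a \<bullet> z"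
    using separating_hyperplane_sets[of ?S "{(x, u x)}"] convex_singleton by blast
  obtain p s where a: "a = (p, s)" by (cases a)
  have sep: "p \<bullet> (y - x) + s * (u y - u x + e) \<le> 0" if "0 < e" for y e
    using bspec[OF ab(2), of "(y, u y + e)"] ab(3) that by (simp add: a inner_diff_right algebra_simps)
  have "s \<le> 0"
    using sep[of 1 x] by simp
  moreover have "s \<noteq> 0"
  proof
    assume "s = 0"
    then have "p \<bullet> p \<le> 0"
      using sep[of 1 "x + p"] by simp
    then have "p = 0"
      using inner_ge_zero[of p] by (simp add: order.eq_iff[of "p \<bullet> p"])
    with \<open>s = 0\<close> ab(1) show False by (simp add: a zero_prod_def)
  qed
  ultimately have s: "s < 0" by simp
  have "u x + (p /\<^sub>R (- s)) \<bullet> (y - x) \<le> u y" for y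
  proof (rule field_le_epsilon)
    fix e :: real assume "0 < e"
    then have "p \<bullet> (y - x) \<le> (- s) * (u y - u x + e)"
      using sep[of e y] by simp
    then have "(p \<bullet> (y - x)) / (- s) \<le> u y - u x + e"
      using s by (simp add: pos_divide_le_eq mult.commute del: divide_minus_right)
    then show "u x + (p /\<^sub>R (- s)) \<bullet> (y - x) \<le> u y + e"
      by (simp add: divide_inverse mult.commute)
  qed
  then have "p /\<^sub>R (- s) \<in> subdifferential u x"
    by (simp add: subdifferential_def)
  then show ?thesis by (rule that)
qed

context pos_def_matrix
begin

lemma quadratic_function_eq: "quadratic_function A b c x = cost x + b \<bullet> x + c"
  by (simp add: quadratic_function_def cost_def)

lemma continuous_on_quadratic_function: "continuous_on S (quadratic_function A b c)"
  unfolding quadratic_function_eq[abs_def] by (intro continuous_intros continuous_on_id)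

text \<open>Adding \<open>cost x\<close> cancels the quadratic part in \<open>x\<close> of \<open>- cost (m - x)\<close>, so the sum is a supremum of affine
  functions of \<open>x\<close>; \<open>l\<close> in the proof is the affine function that touches at the intermediate point.\<close>

lemma convex_transform_add_quadratic:
  assumes w: "admissible w"
  shows "convex_on UNIV (\<lambda>x. transform w x + quadratic_function A b c x)"
proof (rule convex_onI)
  fix t :: real and x y :: "real^'n"
  assume t: "0 < t" "t < 1"
  define p where "p = (1 - t) *\<^sub>R x + t *\<^sub>R y"
  obtain m where m: "m \<in> maximizers w p"
    using maximizers_nonempty[OF w] by blast
  define l where "l z = m \<bullet> (A *v z) - cost m - w m + b \<bullet> z + c" for z
  have l: "l z \<le> transform w z + quadratic_function A b c z" for z
    using transform_ge[OF w, of m z] by (simp add: l_def quadratic_function_eq cost_diff)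
  have "transform w p + quadratic_function A b c p = l p"
    using transform_eq[OF m] by (simp add: l_def quadratic_function_eq cost_diff)
  also have "\<dots> = (1 - t) * l x + t * l y"
    by (simp add: l_def p_def matrix_vector_right_distrib matrix_vector_mult_scaleR inner_add_right algebra_simps)
  also have "\<dots> \<le> (1 - t) * (transform w x + quadratic_function A b c x)
      + t * (transform w y + quadratic_function A b c y)"
    using t by (intro add_mono mult_left_mono l) auto
  finally show "transform w ((1 - t) *\<^sub>R x + t *\<^sub>R y) + quadratic_function A b c ((1 - t) *\<^sub>R x + t *\<^sub>R y)
     \<le> (1 - t) * (transform w x + quadratic_function A b c x)
      + t * (transform w y + quadratic_function A b c y)"
    by (simp only: p_def)
qed auto

text \<open>A subgradient of \<open>v + P\<close> at \<open>x\<close> is a slope \<open>A y + b\<close> for which \<open>x\<close> is a maximizer, and this \<open>y\<close> attains the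
  value \<open>v x\<close> in the second transform.\<close>

lemma transform_transform_of_convex:
  assumes v: "admissible v" and conv: "convex_on UNIV (\<lambda>x. v x + quadratic_function A b c x)"
  shows "transform (transform v) = v"
proof (rule ext, rule antisym)
  fix x
  show "transform (transform v) x \<le> v x"
    by (rule transform_transform_le[OF v])
  obtain p where p: "p \<in> subdifferential (\<lambda>x. v x + quadratic_function A b c x) x"
    using convex_has_subgradient[OF conv] by blast
  obtain y where "A *v y = p - b"
    using surj_A by (metis surjD)
  then have "p = A *v y + b" by simp
  with p have "x \<in> maximizers v y"
    using subdifferential_iff_maximizers by blast
  then show "v x \<le> transform (transform v) x"
    using transform_eq[of x v y] transform_ge[OF admissible_transform[OF v], of y x]
    by (simp add: cost_minus_commute)
qed

section \<open>Uniqueness\<close>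

lemma transform_increment_bounds:
  assumes v: "admissible v" and m: "m \<in> maximizers v y" and m': "m' \<in> maximizers v y'"
  shows "m \<bullet> (A *v (y' - y)) \<le> (transform v y' + cost y') - (transform v y + cost y)"
    and "(transform v y' + cost y') - (transform v y + cost y) \<le> m' \<bullet> (A *v (y' - y))"
  using transform_eq[OF m] transform_eq[OF m'] transform_ge[OF v, of m y'] transform_ge[OF v, of m' y]
  by (simp_all add: cost_diff matrix_vector_mult_diff_distrib inner_diff_right)

text \<open>Both \<open>transform v + cost\<close> and \<open>transform w + cost\<close> have the subgradient \<open>A (m y)\<close> at \<open>y\<close>. Their increments
  over a short step therefore lie in a common interval, and over \<open>N\<close> equal steps along a segment the
  lengths of these intervals telescope to \<open>1/N\<close> times a quantity that does not depend on \<open>N\<close>.\<close>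

lemma transform_diff_constant:
  assumes v: "admissible v" and w: "admissible w"
    and common: "\<And>y. maximizers v y \<inter> maximizers w y \<noteq> {}"
  shows "transform v y - transform w y = transform v 0 - transform w 0"
proof -
  have "\<forall>y. \<exists>x. x \<in> maximizers v y \<inter> maximizers w y"
    using common by blast
  from choice[OF this] obtain m where m: "\<And>y. m y \<in> maximizers v y" "\<And>y. m y \<in> maximizers w y"
    by blast
  define g where "g y = transform v y - transform w y" for y
  have step: "\<bar>g y' - g y\<bar> \<le> (m y' - m y) \<bullet> (A *v (y' - y))" for y y'
    using transform_increment_bounds[OF v m(1)[of y] m(1)[of y']]
      transform_increment_bounds[OF w m(2)[of y] m(2)[of y']]
    by (simp add: g_def inner_diff_left abs_le_iff)
  have "real N * \<bar>g y - g 0\<bar> \<le> (m y - m 0) \<bullet> (A *v y)" if N: "0 < N" for N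
  proof -
    define q where "q i = (real i / real N) *\<^sub>R y" for i
    have q: "q (Suc i) - q i = inverse (real N) *\<^sub>R y" for i
      by (simp add: q_def scaleR_diff_left[symmetric] divide_inverse algebra_simps)
    have "\<bar>g y - g 0\<bar> = \<bar>\<Sum>i<N. g (q (Suc i)) - g (q i)\<bar>"
      using N sum_lessThan_telescope[of "\<lambda>i. g (q i)" N] by (simp add: q_def)
    also have "\<dots> \<le> (\<Sum>i<N. \<bar>g (q (Suc i)) - g (q i)\<bar>)"
      by (rule sum_abs)
    also have "\<dots> \<le> (\<Sum>i<N. (m (q (Suc i)) - m (q i)) \<bullet> (A *v (inverse (real N) *\<^sub>R y)))"
    proof (rule sum_mono)
      fix i
      show "\<bar>g (q (Suc i)) - g (q i)\<bar> \<le> (m (q (Suc i)) - m (q i)) \<bullet> (A *v (inverse (real N) *\<^sub>R y))"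
        using step[of "q (Suc i)" "q i"] unfolding q .
    qed
    also have "\<dots> = (\<Sum>i<N. m (q (Suc i)) - m (q i)) \<bullet> (A *v (inverse (real N) *\<^sub>R y))"
      by (simp only: inner_sum_left)
    also have "(\<Sum>i<N. m (q (Suc i)) - m (q i)) = m y - m 0"
      using N sum_lessThan_telescope[of "\<lambda>i. m (q i)" N] by (simp add: q_def)
    finally have "\<bar>g y - g 0\<bar> \<le> inverse (real N) * ((m y - m 0) \<bullet> (A *v y))"
      by (simp add: matrix_vector_mult_scaleR)
    then show ?thesis
      using N by (simp add: field_simps)
  qed
  note bound = this
  have "\<not> 0 < \<bar>g y - g 0\<bar>"
  proof
    assume "0 < \<bar>g y - g 0\<bar>"
    then obtain N where N: "(m y - m 0) \<bullet> (A *v y) < real N * \<bar>g y - g 0\<bar>"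
      using reals_Archimedean3 by blast
    have "0 \<le> (m y - m 0) \<bullet> (A *v y)"
      using order_trans[OF abs_ge_zero step[of y 0]] by simp
    then have "0 < N"
      using N by (cases "N = 0") auto
    from bound[OF this] N show False by simp
  qed
  then show ?thesis by (simp add: g_def)
qed

lemma closed_common_maximizers:
  assumes v: "admissible v" and w: "admissible w"
  shows "closed {y. maximizers v y \<inter> maximizers w y \<noteq> {}}"
  unfolding closed_sequential_limits
proof (intro allI impI, elim conjE)
  fix y b assume y: "\<forall>k. y k \<in> {y. maximizers v y \<inter> maximizers w y \<noteq> {}}" and lim: "y \<longlonglongrightarrow> b"
  then have "\<forall>k. \<exists>x. x \<in> maximizers v (y k) \<inter> maximizers w (y k)"
    by blast
  then obtain x where x: "\<And>k. x k \<in> maximizers v (y k)" "\<And>k. x k \<in> maximizers w (y k)"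
    by (metis IntD1 IntD2)
  obtain a r where r: "strict_mono r" "(x \<circ> r) \<longlonglongrightarrow> a" and "a \<in> maximizers v b"
    using maximizers_subsequence_limit[OF v lim x(1)] by blast
  moreover have "a \<in> maximizers w b"
    by (rule maximizers_limit[OF w r(2) LIMSEQ_subseq_LIMSEQ[OF lim r(1)]]) (simp add: x)
  ultimately show "b \<in> {y. maximizers v y \<inter> maximizers w y \<noteq> {}}" by blast
qed

end

text \<open>The complement is open and periodic; its measure in a box centred at one of its points equals its
  measure in the unit cell, which is zero.\<close>

lemma closed_periodic_full:
  fixes Z :: "(real^'n) set"
  assumes Z: "closed Z" and per: "\<And>x z. z \<in> integer_lattice \<Longrightarrow> x + z \<in> Z \<longleftrightarrow> x \<in> Z"
    and null: "emeasure lborel (- Z \<inter> unit_cell) = 0"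
  shows "Z = UNIV"
proof (rule ccontr)
  assume "Z \<noteq> UNIV"
  then obtain x where x: "x \<notin> Z" by blast
  define D where "D = {y. \<forall>i. (\<chi> i. x $ i - 1/2) $ i \<le> y $ i \<and> y $ i < (\<chi> i. x $ i - 1/2) $ i + (1::real)}"
  have D: "fundamental_domain D"
    unfolding D_def by (rule fundamental_domain_box)
  then have Db: "D \<in> sets borel" by (simp add: fundamental_domain_def)
  have m: "(indicator (- Z) :: _ \<Rightarrow> ennreal) \<in> borel_measurable borel"
    using Z by simp
  have "(\<integral>\<^sup>+y. indicator (- Z) y * indicator D y \<partial>lborel)
      = (\<integral>\<^sup>+y. indicator (- Z) y * indicator unit_cell y \<partial>lborel)"
    by (rule nn_integral_fundamental_domain_cong[OF sets_lborel lattice_periodic_lborel D fundamental_domain_unit_cell m])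
      (simp add: indicator_def per)
  then have "emeasure lborel (- Z \<inter> D) = 0"
    using null Z Db by (simp add: indicator_inter_arith[symmetric])
  then have N: "- Z \<inter> D \<in> null_sets lborel"
    using Z Db by (auto simp: null_sets_def)
  let ?B = "box (\<chi> i. x $ i - 1/2) (\<chi> i. x $ i + 1/2)"
  have "?B \<subseteq> D"
  proof
    fix y assume y: "y \<in> ?B"
    have "x $ i - 1/2 \<le> y $ i \<and> y $ i < x $ i - 1/2 + 1" for i
      using y[unfolded mem_box_cart, rule_format, of i] by simp
    then show "y \<in> D" by (simp add: D_def)
  qed
  then have "- Z \<inter> ?B \<subseteq> - Z \<inter> D" by blast
  then have "- Z \<inter> ?B \<in> null_sets lborel"
    using Z by (intro null_sets_subset[OF N]) auto
  then have "negligible (- Z \<inter> ?B)"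
    by (simp add: negligible_iff_null_sets null_sets_completionI)
  moreover have "open (- Z \<inter> ?B)"
    using Z by (intro open_Int) auto
  moreover have "x \<in> - Z \<inter> ?B"
    using x by (auto simp: mem_box_cart)
  ultimately show False
    using open_not_negligible by blast
qed

context transport_problem
begin

text \<open>Adding a bound \<open>K\<close> of \<open>\<bar>\<phi>\<bar>\<close> makes the integrand nonnegative and reduces the claim to the
  nonnegative integral.\<close>

lemma integral_target_eq:
  assumes v: "admissible v" and pf: "push_forward v = \<mu>" and \<phi>: "admissible \<phi>"
  shows "(\<integral>x. \<phi> x \<partial>target) = det A * (\<integral>y. \<phi> (optimal_map v y) \<partial>source)"
proof -
  obtain K where K: "\<And>x. \<bar>\<phi> x\<bar> \<le> K"
    using admissible_bounded[OF \<phi>] by blast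
  have pos: "0 \<le> \<phi> x + K" for x
    using K[of x] by (simp add: abs_le_iff)
  have m[measurable]: "\<phi> \<in> borel_measurable borel"
    by (rule admissible_borel[OF \<phi>])
  have comp[measurable]: "(\<lambda>y. \<phi> (optimal_map v y)) \<in> borel_measurable borel"
    using measurable_compose[OF optimal_map_borel[OF v] m] .
  have i1: "integrable target \<phi>" and i2: "integrable source (\<lambda>y. \<phi> (optimal_map v y))"
    using integrable_target[OF m K] integrable_source[OF comp K] .
  have "ennreal (\<integral>x. \<phi> x + K \<partial>target) = (\<integral>\<^sup>+x. ennreal (\<phi> x + K) \<partial>target)"
    using i1 pos by (intro nn_integral_eq_integral[symmetric]) auto
  also have "\<dots> = (\<integral>\<^sup>+x. ennreal (\<phi> x + K) * indicator unit_cell x \<partial>\<mu>)"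
    unfolding target_def using sets_mu
    by (subst nn_integral_density) (auto simp: mult.commute cong: measurable_cong_sets)
  also have "\<dots> = ennreal (det A) * (\<integral>\<^sup>+y. ennreal (\<phi> (optimal_map v y) + K) * indicator unit_cell y \<partial>lborel)"
    unfolding pf[symmetric]
    by (rule nn_integral_push_forward_cell[OF v]) (auto simp: admissible_periodic[OF \<phi>])
  also have "(\<integral>\<^sup>+y. ennreal (\<phi> (optimal_map v y) + K) * indicator unit_cell y \<partial>lborel)
      = (\<integral>\<^sup>+y. ennreal (\<phi> (optimal_map v y) + K) \<partial>source)"
    unfolding source_def by (subst nn_integral_density) (auto simp: mult.commute)
  also have "\<dots> = ennreal (\<integral>y. \<phi> (optimal_map v y) + K \<partial>source)"
    using i2 pos by (intro nn_integral_eq_integral) auto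
  finally have "ennreal (\<integral>x. \<phi> x + K \<partial>target) = ennreal (det A * (\<integral>y. \<phi> (optimal_map v y) + K \<partial>source))"
    using det_pos by (simp add: ennreal_mult' )
  moreover have "0 \<le> (\<integral>x. \<phi> x + K \<partial>target)" "0 \<le> det A * (\<integral>y. \<phi> (optimal_map v y) + K \<partial>source)"
    using pos det_pos by (auto intro!: integral_nonneg_AE mult_nonneg_nonneg)
  ultimately have "(\<integral>x. \<phi> x + K \<partial>target) = det A * (\<integral>y. \<phi> (optimal_map v y) + K \<partial>source)"
    by simp
  then show ?thesis
    using i1 i2 by (simp add: algebra_simps)
qed

lemma dual_functional_eq:
  assumes v: "admissible v" and pf: "push_forward v = \<mu>" and w: "admissible w"
  shows "dual_functional w = det A * (\<integral>y. w (optimal_map v y) + transform w y \<partial>source)"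
    and "integrable source (\<lambda>y. w (optimal_map v y) + transform w y)"
proof -
  obtain K where K: "\<And>x. \<bar>w x\<bar> \<le> K"
    using admissible_bounded[OF w] by blast
  have "integrable source (\<lambda>y. w (optimal_map v y))"
    using integrable_source[OF measurable_compose[OF optimal_map_borel[OF v] admissible_borel[OF w]] K] .
  moreover have "integrable source (transform w)"
    by (intro integrable_source_admissible admissible_transform w)
  ultimately show "dual_functional w = det A * (\<integral>y. w (optimal_map v y) + transform w y \<partial>source)"
    and "integrable source (\<lambda>y. w (optimal_map v y) + transform w y)"
    unfolding dual_functional_def integral_target_eq[OF v pf w] by (auto simp: algebra_simps)
qed

lemma push_forward_gap_nonneg:
  assumes v: "admissible v" and w: "admissible w" and y: "y \<notin> ambiguous v"
  shows "v (optimal_map v y) + transform v y \<le> w (optimal_map v y) + transform w y"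
proof -
  have "optimal_map v y \<in> maximizers v y"
    using maximizers_eq_optimal_map[OF v y] by simp
  from transform_eq[OF this] transform_ge[OF w, of "optimal_map v y" y] show ?thesis by simp
qed

text \<open>By \<open>dual_functional_eq\<close> both values are integrals of \<open>w x + transform w y\<close> along the graph of the same map
  \<open>optimal_map v\<close>, and on that graph \<open>v\<close> attains the lower bound \<open>- cost (x - y)\<close>.\<close>

lemma push_forward_minimizes:
  assumes v: "admissible v" and pf: "push_forward v = \<mu>" and w: "admissible w"
  shows "dual_functional v \<le> dual_functional w"
proof -
  have "(\<integral>y. v (optimal_map v y) + transform v y \<partial>source) \<le> (\<integral>y. w (optimal_map v y) + transform w y \<partial>source)"
  proof (rule integral_mono_AE)
    show "AE y in source. v (optimal_map v y) + transform v y \<le> w (optimal_map v y) + transform w y"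
      using AE_source_not_ambiguous[OF v] by eventually_elim (rule push_forward_gap_nonneg[OF v w])
  qed (use dual_functional_eq(2)[OF v pf] v w in auto)
  then show ?thesis
    using dual_functional_eq(1)[OF v pf] v w det_pos by simp
qed

text \<open>Both \<open>v\<close> and \<open>w\<close> are minimizers, so the nonnegative gap \<open>h\<close> has integral zero; where it vanishes,
  \<open>optimal_map v y\<close> is a maximizer for \<open>w\<close> too. The set of such \<open>y\<close> is closed and
  periodic, which upgrades almost everywhere to everywhere.\<close>

lemma common_maximizers:
  assumes v: "admissible v" and pf: "push_forward v = \<mu>"
    and w: "admissible w" and pf': "push_forward w = \<mu>"
  shows "maximizers v y \<inter> maximizers w y \<noteq> {}"
proof -
  let ?Z = "{y. maximizers v y \<inter> maximizers w y \<noteq> {}}"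
  define h where "h y = (w (optimal_map v y) + transform w y) - (v (optimal_map v y) + transform v y)" for y
  have "dual_functional v = dual_functional w"
    using push_forward_minimizes v w pf pf' by (intro antisym) auto
  then have "(\<integral>y. h y \<partial>source) = 0"
    unfolding h_def using dual_functional_eq[OF v pf v] dual_functional_eq[OF v pf w] det_pos by simp
  moreover have "integrable source h"
    unfolding h_def using dual_functional_eq(2)[OF v pf] v w by auto
  moreover have "AE y in source. 0 \<le> h y"
    using AE_source_not_ambiguous[OF v]
    by eventually_elim (use push_forward_gap_nonneg[OF v w] in \<open>simp add: h_def\<close>)
  ultimately have "AE y in source. h y = 0"
    using integral_nonneg_eq_0_iff_AE by blast
  then have "AE y in source. y \<in> ?Z"
    using AE_source_not_ambiguous[OF v]
  proof eventually_elim
    case (elim y)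
    have m: "optimal_map v y \<in> maximizers v y"
      using maximizers_eq_optimal_map[OF v elim(2)] by simp
    have "transform w y = - cost (optimal_map v y - y) - w (optimal_map v y)"
      using elim(1) transform_eq[OF m] by (simp add: h_def)
    then have "optimal_map v y \<in> maximizers w y"
      using maximizers_iff[OF w] by blast
    with m show ?case by blast
  qed
  moreover have Zb: "- ?Z \<in> sets borel"
    by (intro borel_comp borel_closed closed_common_maximizers v w)
  moreover have "{y \<in> space source. y \<notin> ?Z} = - ?Z" by auto
  ultimately have "emeasure source (- ?Z) = 0"
    using AE_iff_measurable[of "- ?Z" source "\<lambda>y. y \<in> ?Z"] by (simp only: sets_source)
  then have null: "emeasure lborel (- ?Z \<inter> unit_cell) = 0"
    by (simp only: emeasure_source[OF Zb])
  have shift: "y + z \<in> ?Z" if "y \<in> ?Z" "z \<in> integer_lattice" for y z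
    using that maximizers_translate[OF v] maximizers_translate[OF w] by blast
  have per: "y + z \<in> ?Z \<longleftrightarrow> y \<in> ?Z" if z: "z \<in> integer_lattice" for y z
    using shift[OF _ z, of y] shift[OF _ integer_lattice_uminus[OF z], of "y + z"] by auto
  from closed_periodic_full[OF closed_common_maximizers[OF v w] per null] show ?thesis by blast
qed

theorem push_forward_unique:
  assumes v: "admissible v" "push_forward v = \<mu>" "convex_on UNIV (\<lambda>x. v x + quadratic_function A b c x)"
    and w: "admissible w" "push_forward w = \<mu>" "convex_on UNIV (\<lambda>x. w x + quadratic_function A b c x)"
  shows "\<exists>k. \<forall>x. w x = v x + k"
proof -
  define k where "k = transform v 0 - transform w 0"
  have "transform v = (\<lambda>y. transform w y + k)"
    using transform_diff_constant[OF v(1) w(1) common_maximizers[OF v(1,2) w(1,2)]]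
    by (auto simp: k_def algebra_simps fun_eq_iff)
  then have "transform (transform v) = (\<lambda>x. transform (transform w) x - k)"
    using transform_add_const[OF admissible_transform[OF w(1)]] by simp
  then have "v = (\<lambda>x. w x - k)"
    unfolding transform_transform_of_convex[OF v(1,3)] transform_transform_of_convex[OF w(1,3)] .
  then show ?thesis by auto
qed

section \<open>Solutions of the Monge-Ampere equation\<close>

theorem push_forward_exists:
  obtains v where "admissible v" "push_forward v = \<mu>" "convex_on UNIV (\<lambda>x. v x + quadratic_function A b c x)"
proof -
  obtain v where v: "admissible v" "\<And>w. admissible w \<Longrightarrow> dual_functional v \<le> dual_functional w"
    using dual_functional_attains_minimum by blast
  have tv: "admissible (transform (transform v))"
    by (intro admissible_transform v)
  have "dual_functional (transform (transform v)) \<le> dual_functional w" if "admissible w" for w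
    using dual_functional_transform_transform[OF v(1)] v(2)[OF that] by simp
  then have "push_forward (transform (transform v)) = \<mu>"
    by (rule minimizer_pushes_forward[OF tv])
  then show ?thesis
    using tv convex_transform_add_quadratic[OF admissible_transform[OF v(1)]] by (intro that)
qed

end

lemma unit_cell_mass_pos:
  fixes \<mu> :: "(real^'n) measure"
  assumes sets: "sets \<mu> = sets borel" and per: "lattice_periodic_measure \<mu>" and nz: "emeasure \<mu> UNIV \<noteq> 0"
  shows "emeasure \<mu> unit_cell \<noteq> 0"
proof
  assume 0: "emeasure \<mu> unit_cell = 0"
  have translate: "(\<lambda>x. x + z) ` unit_cell \<in> null_sets \<mu>" if z: "z \<in> integer_lattice" for z :: "real^'n"
  proof -
    have "(\<lambda>x. x + z) ` unit_cell \<in> sets \<mu>"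
      unfolding translate_eq_vimage
      using measurable_sets[of "\<lambda>x. x - z" borel borel unit_cell] sets by simp
    moreover have "emeasure \<mu> ((\<lambda>x. x + z) ` unit_cell) = 0"
      using per z 0 unit_cell_borel unfolding lattice_periodic_measure_def by metis
    ultimately show ?thesis by (simp add: null_sets_def)
  qed
  have "(\<Union>z\<in>integer_lattice. (\<lambda>x. x + z) ` unit_cell) \<in> null_sets \<mu>"
    by (intro null_sets_UN' countable_integer_lattice translate)
  moreover have "(\<Union>z\<in>integer_lattice. (\<lambda>x. x + z) ` unit_cell) = (UNIV :: (real^'n) set)"
  proof (intro set_eqI iffI UNIV_I)
    fix x :: "real^'n"
    obtain z where z: "z \<in> integer_lattice" "x + z \<in> unit_cell"
      by (rule lattice_translate_into_unit_cell)
    then have "x \<in> (\<lambda>y. y + - z) ` unit_cell"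
      by (intro image_eqI[of _ _ "x + z"]) auto
    then show "x \<in> (\<Union>z\<in>integer_lattice. (\<lambda>x. x + z) ` unit_cell)"
      using integer_lattice_uminus[OF z(1)] by blast
  qed
  ultimately show False
    using nz by (simp add: null_sets_def)
qed

theorem theorem1p2:
  fixes \<mu> :: "(real ^ 'n) measure"
    and A :: "real ^ 'n ^ 'n" and b :: "real ^ 'n" and c :: real
  assumes "sets \<mu> = sets borel"
    and "locally_finite_measure \<mu>"
    and "emeasure \<mu> UNIV \<noteq> 0"
    and "lattice_periodic_measure \<mu>"
    and "symmetric_positive_definite A"
    and "ennreal (det A) = emeasure \<mu> unit_cell"
  shows "(\<exists>v. lattice_periodic v \<and>
            continuous_on UNIV (\<lambda>x. v x + quadratic_function A b c x) \<and>
            convex_on UNIV (\<lambda>x. v x + quadratic_function A b c x) \<and>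
            alexandrov_solution (\<lambda>x. v x + quadratic_function A b c x) \<mu>) \<and>
         (\<forall>v w. lattice_periodic v \<and>
            continuous_on UNIV (\<lambda>x. v x + quadratic_function A b c x) \<and>
            convex_on UNIV (\<lambda>x. v x + quadratic_function A b c x) \<and>
            alexandrov_solution (\<lambda>x. v x + quadratic_function A b c x) \<mu> \<and>
            lattice_periodic w \<and>
            continuous_on UNIV (\<lambda>x. w x + quadratic_function A b c x) \<and>
            convex_on UNIV (\<lambda>x. w x + quadratic_function A b c x) \<and>
            alexandrov_solution (\<lambda>x. w x + quadratic_function A b c x) \<mu> \<longrightarrow>
            (\<exists>k. \<forall>x. w x = v x + k))"
proof -
  have "emeasure \<mu> unit_cell \<noteq> 0"
    by (rule unit_cell_mass_pos[OF assms(1,4,3)])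
  then have det: "0 < det A"
    using assms(6) by (metis ennreal_eq_0_iff not_le)
  interpret transport_problem A \<mu>
    by unfold_locales (use assms det in auto)
  let ?u = "\<lambda>v x. v x + quadratic_function A b c x"
  have cont: "continuous_on UNIV (?u v) \<longleftrightarrow> continuous_on UNIV v" for v
    using continuous_on_add[OF _ continuous_on_quadratic_function, of UNIV v b c]
      continuous_on_diff[OF _ continuous_on_quadratic_function, of UNIV "?u v" b c] by auto
  have solution_iff: "lattice_periodic v \<and> continuous_on UNIV (?u v) \<and> convex_on UNIV (?u v) \<and> alexandrov_solution (?u v) \<mu>
      \<longleftrightarrow> admissible v \<and> push_forward v = \<mu> \<and> convex_on UNIV (?u v)" for v
    using alexandrov_iff_push_forward[OF _ det assms(1), of v b c]
    unfolding cont by (auto simp: admissible_def)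
  obtain v where "admissible v" "push_forward v = \<mu>" "convex_on UNIV (?u v)"
    by (rule push_forward_exists)
  then have "lattice_periodic v \<and> continuous_on UNIV (?u v) \<and> convex_on UNIV (?u v) \<and> alexandrov_solution (?u v) \<mu>"
    using solution_iff by blast
  moreover have "\<exists>k. \<forall>x. w x = v x + k"
    if "lattice_periodic v \<and> continuous_on UNIV (?u v) \<and> convex_on UNIV (?u v) \<and> alexandrov_solution (?u v) \<mu>"
      "lattice_periodic w \<and> continuous_on UNIV (?u w) \<and> convex_on UNIV (?u w) \<and> alexandrov_solution (?u w) \<mu>" for v w
    using push_forward_unique[of v b c w] that unfolding solution_iff by blast
  ultimately show ?thesis by blast
qed

end
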